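(* Let $D$ be an open disk centered at the origin, let $V\in\mathrm{SH}_0(D)$, and assume that $\partial V/\partial z$ is piecewise holomorphic with respect to a $k$-tuple $g_1,\ldots,g_k\in\mathcal O(D)$. Put $K=\mathrm{supp}(\Delta V)$ and let $U_\nu$ be the union of those connected components of $D\setminus K$ where $\partial V/\partial z=g_\nu$. Assume that the origin belongs to the closure of $U_\nu$ for every $1\le\nu\le k$, and that $g_1(0),\ldots,g_k(0)$ are pairwise distinct and each $g_i(0)$ is an extreme point of the convex hull of $\{g_1(0),\ldots,g_k(0)\}$. Let $H_1,\ldots,H_k$ be the harmonic functions in $D$ with $\partial H_\nu/\partial z=g_\nu$ and $H_\nu(0)=0$. Then there exists $c\in\mathbf{R}$ such that $V=\max(H_1,\ldots,H_k)+c$ in a neighborhood of the origin.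
   Context: "Null set" means Lebesgue measure zero; $\partial/\partial z=\frac12(\partial/\partial x-i\,\partial/\partial y)$; harmonic functions are real-valued. $\mathrm{SH}_0(D)$ is the class of subharmonic functions $V$ in $D$ (upper semicontinuous) such that the support $\mathrm{supp}(\Delta V)$ of the distributional Laplacian is a null set; then $\partial V/\partial z$ is holomorphic in $D\setminus\mathrm{supp}(\Delta V)$. $\partial V/\partial z$ is piecewise holomorphic with respect to $g_1,\ldots,g_k$ if on every connected component of $D\setminus\mathrm{supp}(\Delta V)$ it coincides with some $g_j$. *)

theory Defs
  imports "HOL-Analysis.Analysis"
begin

section \<open>Differential operators in the plane\<close>

text \<open>The complex number \<open>x + \<i> y\<close> stands for the point \<open>(x, y)\<close>; the real derivative of a
  function at a point, applied to \<open>1\<close> and to \<open>\<i>\<close>, gives the two partial derivatives.\<close>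

definition partial_x :: "(complex \<Rightarrow> real) \<Rightarrow> complex \<Rightarrow> real" where
  "partial_x f z = frechet_derivative f (at z) 1"

definition partial_y :: "(complex \<Rightarrow> real) \<Rightarrow> complex \<Rightarrow> real" where
  "partial_y f z = frechet_derivative f (at z) \<i>"

definition laplacian :: "(complex \<Rightarrow> real) \<Rightarrow> complex \<Rightarrow> real" where
  "laplacian f z = partial_x (partial_x f) z + partial_y (partial_y f) z"

text \<open>\<open>has_dz f d z\<close>: \<open>f\<close> is (real) differentiable at \<open>z\<close> and
  \<open>\<partial>f/\<partial>z = (\<partial>f/\<partial>x - \<i> \<partial>f/\<partial>y) / 2\<close> has the value \<open>d\<close> there.\<close>

definition has_dz :: "(complex \<Rightarrow> real) \<Rightarrow> complex \<Rightarrow> complex \<Rightarrow> bool" where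
  "has_dz f d z \<longleftrightarrow>
     f differentiable (at z) \<and>
     d = (complex_of_real (partial_x f z) - \<i> * complex_of_real (partial_y f z)) / 2"

text \<open>Continuous differentiability of order \<open>n\<close>, meant for open sets \<open>S\<close>.\<close>

fun Cn_on :: "nat \<Rightarrow> (complex \<Rightarrow> real) \<Rightarrow> complex set \<Rightarrow> bool" where
  "Cn_on 0 f S \<longleftrightarrow> continuous_on S f"
| "Cn_on (Suc n) f S \<longleftrightarrow>
     (\<forall>z\<in>S. f differentiable (at z)) \<and> Cn_on n (partial_x f) S \<and> Cn_on n (partial_y f) S"

definition harmonic_on :: "(complex \<Rightarrow> real) \<Rightarrow> complex set \<Rightarrow> bool" where
  "harmonic_on f S \<longleftrightarrow> Cn_on 2 f S \<and> (\<forall>z\<in>S. laplacian f z = 0)"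


section \<open>Distributions\<close>

definition test_function_on :: "complex set \<Rightarrow> (complex \<Rightarrow> real) \<Rightarrow> bool" where
  "test_function_on W \<phi> \<longleftrightarrow>
     (\<forall>n. Cn_on n \<phi> UNIV) \<and> compact (closure {z. \<phi> z \<noteq> 0}) \<and> closure {z. \<phi> z \<noteq> 0} \<subseteq> W"

text \<open>The support, relative to the open set \<open>D\<close>, of a linear functional \<open>T\<close> on the test functions
  on \<open>D\<close>: the complement in \<open>D\<close> of the largest open set on which \<open>T\<close> vanishes.\<close>

definition dist_support :: "complex set \<Rightarrow> ((complex \<Rightarrow> real) \<Rightarrow> real) \<Rightarrow> complex set" where
  "dist_support D T =
     {z \<in> D. \<forall>W. open W \<and> z \<in> W \<and> W \<subseteq> D \<longrightarrow> (\<exists>\<phi>. test_function_on W \<phi> \<and> T \<phi> \<noteq> 0)}"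

text \<open>A subharmonic function is locally integrable and its set of poles \<open>{V = -\<infinity>}\<close> is a null set,
  so the value \<open>0\<close> that \<^const>\<open>real_of_ereal\<close> gives at the poles does not affect the integral.\<close>

definition dist_laplacian :: "complex set \<Rightarrow> (complex \<Rightarrow> ereal) \<Rightarrow> (complex \<Rightarrow> real) \<Rightarrow> real" where
  "dist_laplacian D V \<phi> = (LINT z:D|lborel. real_of_ereal (V z) * laplacian \<phi> z)"

definition supp_laplacian :: "complex set \<Rightarrow> (complex \<Rightarrow> ereal) \<Rightarrow> complex set" where
  "supp_laplacian D V = dist_support D (dist_laplacian D V)"


section \<open>Subharmonic functions\<close>

definition usc_on :: "complex set \<Rightarrow> (complex \<Rightarrow> ereal) \<Rightarrow> bool" where
  "usc_on D V \<longleftrightarrow> (\<forall>a. openin (top_of_set D) {z \<in> D. V z < a})"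

text \<open>The mean of \<open>V\<close> over the circle of radius \<open>r\<close> about \<open>a\<close>, as an extended real: the integral
  of the positive part minus the integral of the negative part (\<^const>\<open>e2ennreal\<close> sends negative
  numbers to \<open>0\<close>). For an upper semicontinuous \<open>V < \<infinity>\<close> the first integral is finite.\<close>

definition circle_mean :: "(complex \<Rightarrow> ereal) \<Rightarrow> complex \<Rightarrow> real \<Rightarrow> ereal" where
  "circle_mean V a r =
     (enn2ereal (\<integral>\<^sup>+t\<in>{0..2 * pi}. e2ennreal (V (a + of_real r * cis t)) \<partial>lborel)
      - enn2ereal (\<integral>\<^sup>+t\<in>{0..2 * pi}. e2ennreal (- V (a + of_real r * cis t)) \<partial>lborel))
     / ereal (2 * pi)"

text \<open>Subharmonic functions on an open set \<open>D\<close> take values in \<open>[-\<infinity>, \<infinity>)\<close>; the function that is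
  identically \<open>-\<infinity>\<close> on some component is excluded, since it has no distributional Laplacian.\<close>

definition subharmonic_on :: "complex set \<Rightarrow> (complex \<Rightarrow> ereal) \<Rightarrow> bool" where
  "subharmonic_on D V \<longleftrightarrow>
     (\<forall>z\<in>D. V z \<noteq> \<infinity>) \<and>
     (\<forall>C\<in>components D. \<exists>z\<in>C. V z \<noteq> -\<infinity>) \<and>
     usc_on D V \<and>
     (\<forall>a r. 0 < r \<and> cball a r \<subseteq> D \<longrightarrow> V a \<le> circle_mean V a r)"

definition SH0 :: "complex set \<Rightarrow> (complex \<Rightarrow> ereal) set" where
  "SH0 D = {V. subharmonic_on D V \<and> supp_laplacian D V \<in> null_sets lebesgue}"

text \<open>Off the support of its Laplacian a subharmonic function is finite and harmonic, so there
  \<open>\<partial>V/\<partial>z\<close> exists in the classical sense.\<close>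

definition dz_eq_on :: "(complex \<Rightarrow> ereal) \<Rightarrow> (complex \<Rightarrow> complex) \<Rightarrow> complex set \<Rightarrow> bool" where
  "dz_eq_on V g C \<longleftrightarrow> (\<forall>z\<in>C. has_dz (\<lambda>w. real_of_ereal (V w)) (g z) z)"

definition dz_piecewise_holomorphic ::
    "complex set \<Rightarrow> (complex \<Rightarrow> ereal) \<Rightarrow> nat \<Rightarrow> (nat \<Rightarrow> complex \<Rightarrow> complex) \<Rightarrow> bool" where
  "dz_piecewise_holomorphic D V k g \<longleftrightarrow>
     (\<forall>C\<in>components (D - supp_laplacian D V). \<exists>j\<in>{1..k}. dz_eq_on V (g j) C)"

end

theory Submission
  imports Defs "HOL-Complex_Analysis.Complex_Analysis"
begin

text \<open>Fix an index \<open>i\<close> and put \<open>f = exp (V - H\<^sub>i)\<close>, a bounded nonnegative subharmonic function. As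
  \<open>g\<^sub>i(0)\<close> is an extreme point, there is an open cone of directions along which, near the origin, the
  derivative of \<open>V - H\<^sub>i\<close> is \<open>\<le> 0\<close> off the null set \<open>K\<close>. That \<open>f\<close> is then decreasing along the
  cone (no singular part of the gradient lives on \<open>K\<close>) follows from an \<open>L\<^sup>2\<close> bound on difference
  quotients: writing \<open>A\<^sub>r\<close> for the mean over disks of radius \<open>r\<close>, subharmonicity gives that the mean of
  \<open>(f(z + u) - f(z))\<^sup>2\<close> over \<open>|u| < r\<close> is at most \<open>A\<^sub>r(f\<^sup>2)(z) - f(z)\<^sup>2\<close>, and against a bump function
  \<open>\<psi>\<close> the latter integrates to \<open>\<integral> f\<^sup>2 (A\<^sub>r \<psi> - \<psi>) = O(r\<^sup>2)\<close>.

  At a point of \<open>U\<^sub>i\<close> the function \<open>f\<close> is locally constant, so by monotonicity and the maximum principle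
  it is constant on the cone with that vertex. Letting the vertices tend to the origin gives \<open>c\<^sub>i\<close> with
  \<open>V \<ge> H\<^sub>i + c\<^sub>i\<close> near the origin, and equality on \<open>U\<^sub>i\<close> and on a ray from the origin. Comparing two indices
  along these rays shows that all \<open>c\<^sub>i\<close> agree.\<close>


text \<open>The obstacle is that a sign of the derivative off a null set does not by itself control
  a function: the Cantor function has derivative 0 almost everywhere and still increases. Difference
  quotients bounded in the square mean exclude this, because they are uniformly integrable: their
  part above a level \<open>L\<close> contributes only \<open>O(1/L)\<close> to an integral. The
  exponential makes such a quadratic estimate available. It turns poles of \<open>V\<close> into
  zeros, is bounded on smaller disks, and inherits the mean value inequality because exp is convex
  and increasing while \<open>H_i\<close> has the exact mean value property.

  Where \<open>\<partial>V/\<partial>z = g_j\<close>, the derivative of \<open>V - H_i\<close> in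
  direction \<open>h\<close> is \<open>2 Re ((g_j - g_i) h)\<close>. A line separating the extreme
  point \<open>g_i(0)\<close> from the other values yields one \<open>h\<close> that makes this
  negative at the origin for all other \<open>j\<close> at once; finiteness and continuity widen it
  to a cone. An open set of directions, not just one ray, is needed so that cones with different
  vertices near the origin overlap.\<close>

section \<open>Lebesgue measure in the plane\<close>

declare borel_open [OF open_ball, measurable]

text \<open>Boxes determine Lebesgue measure, and a box of complex numbers is a rectangle in the
  real and imaginary parts. This makes Fubini available in these two coordinates.\<close>

lemma lborel_complex:
  "(lborel :: complex measure) = distr (lborel \<Otimes>\<^sub>M lborel) borel (\<lambda>(x, y). Complex x y)"
proof (rule lborel_eqI)
  have meas: "(\<lambda>(x, y). Complex x y) \<in> borel_measurable (lborel \<Otimes>\<^sub>M lborel)"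
    unfolding complex_eq_iff Complex_eq by measurable
  fix l u :: complex
  assume le: "\<And>b. b \<in> Basis \<Longrightarrow> l \<bullet> b \<le> u \<bullet> b"
  have 1: "Re l \<le> Re u" "Im l \<le> Im u"
    using le[of 1] le[of \<i>] by (auto simp: Basis_complex_def)
  have "emeasure (distr (lborel \<Otimes>\<^sub>M lborel) borel (\<lambda>(x, y). Complex x y)) (box l u)
      = emeasure (lborel \<Otimes>\<^sub>M lborel) ({Re l<..<Re u} \<times> {Im l<..<Im u})"
    by (subst emeasure_distr[OF meas])
       (auto intro!: arg_cong[where f = "emeasure _"] simp: mem_box Basis_complex_def space_pair_measure)
  also have "\<dots> = ennreal (Re u - Re l) * ennreal (Im u - Im l)"
    by (subst lborel.emeasure_pair_measure_Times) (use 1 in auto)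
  also have "\<dots> = ennreal (\<Prod>b\<in>Basis. (u - l) \<bullet> b)"
    using 1 by (simp add: Basis_complex_def ennreal_mult)
  finally show "emeasure (distr (lborel \<Otimes>\<^sub>M lborel) borel (\<lambda>(x, y). Complex x y)) (box l u)
      = ennreal (\<Prod>b\<in>Basis. (u - l) \<bullet> b)" .
qed simp

lemma measurable_Complex [measurable (raw)]:
  assumes "f \<in> borel_measurable M" "g \<in> borel_measurable M"
  shows "(\<lambda>x. Complex (f x) (g x)) \<in> borel_measurable M"
  unfolding Complex_eq using assms by measurable

lemma nn_integral_complex:
  fixes f :: "complex \<Rightarrow> ennreal"
  assumes [measurable]: "f \<in> borel_measurable borel"
  shows "(\<integral>\<^sup>+z. f z \<partial>lborel) = (\<integral>\<^sup>+x. \<integral>\<^sup>+y. f (Complex x y) \<partial>lborel \<partial>lborel)"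
    and "(\<integral>\<^sup>+z. f z \<partial>lborel) = (\<integral>\<^sup>+y. \<integral>\<^sup>+x. f (Complex x y) \<partial>lborel \<partial>lborel)"
proof -
  have "(\<integral>\<^sup>+z. f z \<partial>lborel) = (\<integral>\<^sup>+p. f (case p of (x, y) \<Rightarrow> Complex x y) \<partial>(lborel \<Otimes>\<^sub>M lborel))"
    by (subst lborel_complex, subst nn_integral_distr) (auto simp: case_prod_beta)
  also have "\<dots> = (\<integral>\<^sup>+x. \<integral>\<^sup>+y. f (Complex x y) \<partial>lborel \<partial>lborel)"
    by (subst lborel.nn_integral_fst[symmetric]) (auto simp: case_prod_beta)
  finally show 1: "(\<integral>\<^sup>+z. f z \<partial>lborel) = (\<integral>\<^sup>+x. \<integral>\<^sup>+y. f (Complex x y) \<partial>lborel \<partial>lborel)" .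
  show "(\<integral>\<^sup>+z. f z \<partial>lborel) = (\<integral>\<^sup>+y. \<integral>\<^sup>+x. f (Complex x y) \<partial>lborel \<partial>lborel)"
    unfolding 1 by (rule lborel_pair.Fubini') (auto simp: case_prod_beta)
qed

lemma nn_integral_lborel_translation:
  fixes f :: "'a::euclidean_space \<Rightarrow> ennreal"
  assumes [measurable]: "f \<in> borel_measurable borel"
  shows "(\<integral>\<^sup>+x. f (x + c) \<partial>lborel) = (\<integral>\<^sup>+x. f x \<partial>lborel)"
proof -
  have "(\<integral>\<^sup>+x. f x \<partial>lborel) = (\<integral>\<^sup>+x. f x \<partial>distr lborel borel ((+) c))"
    by (simp add: lborel_distr_plus)
  also have "\<dots> = (\<integral>\<^sup>+x. f (x + c) \<partial>lborel)"
    by (subst nn_integral_distr) (auto simp: add.commute)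
  finally show ?thesis by simp
qed

text \<open>On each horizontal or vertical line a shear is a translation, so the inner integral of
  Fubini does not change. Shears are wanted as factors of rotations.\<close>

lemma nn_integral_shear:
  fixes f :: "complex \<Rightarrow> ennreal"
  assumes [measurable]: "f \<in> borel_measurable borel"
  shows "(\<integral>\<^sup>+z. f (Complex (Re z + a * Im z) (Im z)) \<partial>lborel) = (\<integral>\<^sup>+z. f z \<partial>lborel)"
    and "(\<integral>\<^sup>+z. f (Complex (Re z) (Im z + a * Re z)) \<partial>lborel) = (\<integral>\<^sup>+z. f z \<partial>lborel)"
proof -
  have "(\<integral>\<^sup>+z. f (Complex (Re z + a * Im z) (Im z)) \<partial>lborel)
      = (\<integral>\<^sup>+y. \<integral>\<^sup>+x. f (Complex (x + a * y) y) \<partial>lborel \<partial>lborel)"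
    by (subst nn_integral_complex(2)) auto
  also have "\<dots> = (\<integral>\<^sup>+y. \<integral>\<^sup>+x. f (Complex x y) \<partial>lborel \<partial>lborel)"
    by (subst nn_integral_lborel_translation[where f = "\<lambda>x. f (Complex x _)"]) auto
  finally show "(\<integral>\<^sup>+z. f (Complex (Re z + a * Im z) (Im z)) \<partial>lborel) = (\<integral>\<^sup>+z. f z \<partial>lborel)"
    by (subst nn_integral_complex(2)[of f]) auto
  have "(\<integral>\<^sup>+z. f (Complex (Re z) (Im z + a * Re z)) \<partial>lborel)
      = (\<integral>\<^sup>+x. \<integral>\<^sup>+y. f (Complex x (y + a * x)) \<partial>lborel \<partial>lborel)"
    by (subst nn_integral_complex(1)) auto
  also have "\<dots> = (\<integral>\<^sup>+x. \<integral>\<^sup>+y. f (Complex x y) \<partial>lborel \<partial>lborel)"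
    by (subst nn_integral_lborel_translation[where f = "\<lambda>y. f (Complex _ y)"]) auto
  finally show "(\<integral>\<^sup>+z. f (Complex (Re z) (Im z + a * Re z)) \<partial>lborel) = (\<integral>\<^sup>+z. f z \<partial>lborel)"
    by (subst nn_integral_complex(1)[of f]) auto
qed

lemma nn_integral_rotation:
  fixes f :: "complex \<Rightarrow> ennreal"
  assumes [measurable]: "f \<in> borel_measurable borel" and "cmod c = 1"
  shows "(\<integral>\<^sup>+z. f (c * z) \<partial>lborel) = (\<integral>\<^sup>+z. f z \<partial>lborel)"
proof -
  have *: "(\<integral>\<^sup>+z. f (c * z) \<partial>lborel) = (\<integral>\<^sup>+z. f z \<partial>lborel)"
    if [measurable]: "f \<in> borel_measurable borel" and c: "cmod c = 1" "c \<noteq> -1"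
    for c and f :: "complex \<Rightarrow> ennreal"
  proof -
    \<comment> \<open>A rotation by an angle \<open>\<theta> \<noteq> \<pi>\<close> is a product of three shears, with
      \<open>t = tan (\<theta> / 2)\<close>.\<close>
    define t where "t = Im c / (1 + Re c)"
    have norm: "(Re c)\<^sup>2 + (Im c)\<^sup>2 = 1"
      using c(1) by (metis cmod_power2 one_power2)
    have "Re c \<noteq> -1"
    proof
      assume "Re c = -1"
      with norm have "Im c = 0" by simp
      with \<open>Re c = -1\<close> c(2) show False by (simp add: complex_eq_iff)
    qed
    hence ne: "1 + Re c \<noteq> 0" by simp
    have t1: "t * (1 + Re c) = Im c" using ne by (simp add: t_def)
    \<comment> \<open>For \<open>c = cis \<theta>\<close>, \<open>t1\<close> and \<open>t2\<close>
      are the two half-angle formulas for \<open>tan (\<theta> / 2)\<close>; the product of the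
      three shears reduces to them.\<close>
    have t2: "t * Im c = 1 - Re c"
    proof -
      have "t * Im c * (1 + Re c) = (t * (1 + Re c)) * Im c"
        by (simp add: mult_ac)
      also have "\<dots> = (1 - Re c) * (1 + Re c)"
        unfolding t1 using norm by (simp add: power2_eq_square algebra_simps)
      finally have "t * Im c * (1 + Re c) = (1 - Re c) * (1 + Re c)" .
      thus ?thesis using mult_right_cancel[OF ne] by blast
    qed
    let ?X = "\<lambda>z. Complex (Re z + (-t) * Im z) (Im z)" and ?Y = "\<lambda>z. Complex (Re z) (Im z + Im c * Re z)"
    have eq: "c * z = ?X (?Y (?X z))" for z
    proof -
      have "Re c * Re z - Im c * Im z = (1 - t * Im c) * Re z - (t + t * (1 - t * Im c)) * Im z"
        unfolding t2 using t1 by (simp add: algebra_simps)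
      moreover have "Im c * Re z + Re c * Im z = Im c * Re z + (1 - t * Im c) * Im z"
        unfolding t2 by simp
      ultimately show ?thesis
        by (simp add: complex_eq_iff algebra_simps)
    qed
    have "(\<integral>\<^sup>+z. f (c * z) \<partial>lborel) = (\<integral>\<^sup>+z. f (?X (?Y (?X z))) \<partial>lborel)"
      unfolding eq ..
    also have "\<dots> = (\<integral>\<^sup>+z. f (?X (?Y z)) \<partial>lborel)"
      using nn_integral_shear(1)[of "\<lambda>z. f (?X (?Y z))" "-t"] by simp
    also have "\<dots> = (\<integral>\<^sup>+z. f (?X z) \<partial>lborel)"
      using nn_integral_shear(2)[of "\<lambda>z. f (?X z)" "Im c"] by simp
    also have "\<dots> = (\<integral>\<^sup>+z. f z \<partial>lborel)"
      using nn_integral_shear(1)[of f "-t"] by simp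
    finally show ?thesis .
  qed
  show ?thesis
  proof (cases "c = -1")
    \<comment> \<open>The half turn, where \<open>tan (\<theta> / 2)\<close> has its pole, is a
      product of two quarter turns.\<close>
    case True
    have "(\<integral>\<^sup>+z. f (c * z) \<partial>lborel) = (\<integral>\<^sup>+z. f (\<i> * (\<i> * z)) \<partial>lborel)"
      using True by (simp flip: mult.assoc)
    also have "\<dots> = (\<integral>\<^sup>+z. f z \<partial>lborel)"
      using *[of "\<lambda>z. f (\<i> * z)" "\<i>"] *[of f "\<i>"] by (simp add: complex_eq_iff)
    finally show ?thesis .
  qed (use * assms in auto)
qed

text \<open>The window \<open>{\<theta>..<p + \<theta>}\<close> is cut at \<open>p\<close>, and the
  piece beyond is moved back by one period. With half-open intervals the pieces fit without
  overlap.\<close>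

lemma nn_integral_periodic_shift:
  fixes F :: "real \<Rightarrow> ennreal"
  assumes [measurable]: "F \<in> borel_measurable borel"
    and per: "\<And>t. F (t + p) = F t" and \<theta>: "0 \<le> \<theta>" "\<theta> \<le> p"
  shows "(\<integral>\<^sup>+t\<in>{0..<p}. F (t + \<theta>) \<partial>lborel) = (\<integral>\<^sup>+t\<in>{0..<p}. F t \<partial>lborel)"
proof -
  have "(\<integral>\<^sup>+t\<in>{0..<p}. F (t + \<theta>) \<partial>lborel)
      = (\<integral>\<^sup>+t. (F (t + \<theta>) * indicator {\<theta>..<p + \<theta>} (t + \<theta>)) \<partial>lborel)"
    by (intro nn_integral_cong) (auto simp: indicator_def)
  also have "\<dots> = (\<integral>\<^sup>+t. (F t * indicator {\<theta>..<p + \<theta>} t) \<partial>lborel)"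
    by (rule nn_integral_lborel_translation[where f = "\<lambda>t. F t * indicator {\<theta>..<p + \<theta>} t"]) simp
  also have "\<dots> = (\<integral>\<^sup>+t. (F t * indicator {\<theta>..<p} t + F t * indicator {p..<p + \<theta>} t) \<partial>lborel)"
    using \<theta> by (intro nn_integral_cong) (auto simp: indicator_def)
  also have "\<dots> = (\<integral>\<^sup>+t. F t * indicator {\<theta>..<p} t \<partial>lborel) + (\<integral>\<^sup>+t. F t * indicator {p..<p + \<theta>} t \<partial>lborel)"
    by (rule nn_integral_add) auto
  also have "(\<integral>\<^sup>+t. F t * indicator {p..<p + \<theta>} t \<partial>lborel)
      = (\<integral>\<^sup>+t. F (t + p) * indicator {p..<p + \<theta>} (t + p) \<partial>lborel)"
    by (rule nn_integral_lborel_translation[symmetric, where f = "\<lambda>t. F t * indicator {p..<p + \<theta>} t"]) simp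
  also have "\<dots> = (\<integral>\<^sup>+t. F t * indicator {0..<\<theta>} t \<partial>lborel)"
    by (intro nn_integral_cong) (auto simp: indicator_def per)
  also have "(\<integral>\<^sup>+t. F t * indicator {\<theta>..<p} t \<partial>lborel) + (\<integral>\<^sup>+t. F t * indicator {0..<\<theta>} t \<partial>lborel)
      = (\<integral>\<^sup>+t. (F t * indicator {\<theta>..<p} t + F t * indicator {0..<\<theta>} t) \<partial>lborel)"
    by (rule nn_integral_add[symmetric]) auto
  also have "\<dots> = (\<integral>\<^sup>+t\<in>{0..<p}. F t \<partial>lborel)"
    using \<theta> by (intro nn_integral_cong) (auto simp: indicator_def)
  finally show ?thesis .
qed

text \<open>Instead of polar coordinates: the integral over the disk does not change under rotations, so
  it can be averaged over them, and Fubini turns the average into circle means.\<close>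

lemma disk_integral_ge_of_circle_integral_ge:
  fixes W :: "complex \<Rightarrow> ennreal"
  assumes [measurable]: "W \<in> borel_measurable borel"
    and circ: "\<And>s. 0 < s \<Longrightarrow> s < r \<Longrightarrow>
      ennreal (2 * pi) * w \<le> (\<integral>\<^sup>+t\<in>{0..2*pi}. W (a + of_real s * cis t) \<partial>lborel)"
  shows "w * emeasure lborel (ball (0::complex) r) \<le> (\<integral>\<^sup>+u\<in>ball 0 r. W (a + u) \<partial>lborel)"
proof -
  \<comment> \<open>The hypothesis parametrises the circle from angle 0. Starting at the argument
    \<open>\<theta>\<close> of \<open>u\<close> instead is a periodic shift, after which the
    parametrisation is the orbit of \<open>u\<close> under rotations.\<close>
  have point: "ennreal (2 * pi) * w \<le> (\<integral>\<^sup>+t\<in>{0..<2*pi}. W (a + u * cis t) \<partial>lborel)"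
    if "u \<in> ball 0 r" "u \<noteq> 0" for u
  proof -
    have u: "0 < cmod u" "cmod u < r" using that by auto
    obtain \<theta> where \<theta>: "0 \<le> \<theta>" "\<theta> < 2 * pi" "u = of_real (cmod u) * cis \<theta>"
      using that[of "Arg2pi u", OF Arg2pi_ge_0 Arg2pi_lt_2pi] Arg2pi_eq[of u]
      unfolding cis_conv_exp by blast
    have "ennreal (2 * pi) * w \<le> (\<integral>\<^sup>+t\<in>{0..2*pi}. W (a + of_real (cmod u) * cis t) \<partial>lborel)"
      by (rule circ[OF u])
    also have "\<dots> = (\<integral>\<^sup>+t\<in>{0..<2*pi}. W (a + of_real (cmod u) * cis t) \<partial>lborel)"
      using AE_lborel_singleton[of "2*pi"]
      by (intro nn_integral_cong_AE) (auto elim!: eventually_mono simp: indicator_def)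
    also have "\<dots> = (\<integral>\<^sup>+t\<in>{0..<2*pi}. W (a + of_real (cmod u) * cis (t + \<theta>)) \<partial>lborel)"
      by (rule nn_integral_periodic_shift[symmetric, where F = "\<lambda>t. W (a + of_real (cmod u) * cis t)"])
         (use \<theta> in \<open>auto simp: cis.code cis_conv_exp\<close>)
    also have "\<dots> = (\<integral>\<^sup>+t\<in>{0..<2*pi}. W (a + u * cis t) \<partial>lborel)"
      by (subst (2) \<theta>(3)) (simp add: cis_mult mult_ac add_ac flip: cis_mult)
    finally show ?thesis .
  qed
  have [measurable]: "(indicator (ball 0 r) :: complex \<Rightarrow> ennreal) \<in> borel_measurable borel"
    by (simp add: borel_measurable_indicator)
  have cismeas[measurable]: "cis \<in> borel_measurable borel"
    unfolding cis_conv_exp by measurable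
  have [measurable]: "(\<lambda>p. indicator (ball 0 r) (snd p) :: ennreal)
        \<in> borel_measurable ((lborel :: real measure) \<Otimes>\<^sub>M (lborel :: complex measure))"
      "(\<lambda>p. indicator {0..<2 * pi} (fst p) :: ennreal)
        \<in> borel_measurable ((lborel :: real measure) \<Otimes>\<^sub>M (lborel :: complex measure))"
    by (rule measurable_compose[OF measurable_snd] measurable_compose[OF measurable_fst],
        simp add: borel_measurable_indicator)+
  have inner: "(\<integral>\<^sup>+u. W (a + u * cis t) * indicator (ball 0 r) u \<partial>lborel)
      = (\<integral>\<^sup>+u\<in>ball 0 r. W (a + u) \<partial>lborel)" for t
    using nn_integral_rotation[of "\<lambda>u. W (a + u) * indicator (ball 0 r) u" "cis t"]
    by (simp add: indicator_def norm_mult mult_ac)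
  have "ennreal (2 * pi) * (w * emeasure lborel (ball (0::complex) r))
      = (\<integral>\<^sup>+u. (ennreal (2 * pi) * w) * indicator (ball (0::complex) r) u \<partial>lborel)"
    by (subst nn_integral_cmult_indicator) (auto simp: mult_ac)
  also have "\<dots> \<le> (\<integral>\<^sup>+u. (\<integral>\<^sup>+t\<in>{0..<2*pi}. W (a + u * cis t) \<partial>lborel) * indicator (ball 0 r) u \<partial>lborel)"
    using AE_lborel_singleton[of "0::complex"] point
    by (intro nn_integral_mono_AE) (auto elim!: eventually_mono simp: indicator_def)
  also have "\<dots> = (\<integral>\<^sup>+u. \<integral>\<^sup>+t. W (a + u * cis t) * indicator (ball 0 r) u * indicator {0..<2*pi} t \<partial>lborel \<partial>lborel)"
    by (subst nn_integral_multc[symmetric]) (auto simp: mult_ac intro!: nn_integral_cong)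
  also have "\<dots> = (\<integral>\<^sup>+t. \<integral>\<^sup>+u. W (a + u * cis t) * indicator (ball 0 r) u * indicator {0..<2*pi} t \<partial>lborel \<partial>lborel)"
    by (rule lborel_pair.Fubini') (unfold case_prod_beta, measurable)
  also have "\<dots> = (\<integral>\<^sup>+t. (\<integral>\<^sup>+u\<in>ball 0 r. W (a + u) \<partial>lborel) * indicator {0..<2*pi} t \<partial>lborel)"
    by (subst nn_integral_multc) (auto simp: inner)
  also have "\<dots> = ennreal (2 * pi) * (\<integral>\<^sup>+u\<in>ball 0 r. W (a + u) \<partial>lborel)"
    by (subst nn_integral_cmult_indicator) (auto simp: mult_ac)
  finally show ?thesis
    by (subst (asm) ennreal_mult_le_mult_iff) auto
qed


section \<open>An energy estimate for bounded nonnegative subharmonic functions\<close>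

lemma integral_lborel_translation:
  fixes f :: "'a::euclidean_space \<Rightarrow> real"
  assumes [measurable]: "f \<in> borel_measurable borel"
  shows "(\<integral>x. f (x + c) \<partial>lborel) = (\<integral>x. f x \<partial>lborel)"
proof -
  have "(\<integral>x. f x \<partial>lborel) = (\<integral>x. f x \<partial>distr lborel borel ((+) c))"
    by (simp add: lborel_distr_plus)
  also have "\<dots> = (\<integral>x. f (x + c) \<partial>lborel)"
    by (subst integral_distr) (auto simp: add.commute)
  finally show ?thesis by simp
qed

text \<open>The reflection in the origin is the rotation by \<open>-1\<close>. This discards the
  first-order term of an expansion integrated over a disk about 0.\<close>

lemma integral_lborel_odd:
  fixes f :: "complex \<Rightarrow> real"
  assumes [measurable]: "f \<in> borel_measurable borel" and "integrable lborel f"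
    and odd: "\<And>z. f (-z) = - f z"
  shows "(\<integral>z. f z \<partial>lborel) = 0"
proof -
  have pm: "(\<integral>\<^sup>+z. g (-z) \<partial>lborel) = (\<integral>\<^sup>+z. g z \<partial>lborel)"
    if [measurable]: "g \<in> borel_measurable borel" for g :: "complex \<Rightarrow> ennreal"
    using nn_integral_rotation[of g "-1"] by simp
  have "(\<integral>z. f z \<partial>lborel)
      = enn2real (\<integral>\<^sup>+z. ennreal (f z) \<partial>lborel) - enn2real (\<integral>\<^sup>+z. ennreal (f (-z)) \<partial>lborel)"
    unfolding odd using assms(2) by (rule real_lebesgue_integral_def)
  thus ?thesis using pm[of "\<lambda>z. ennreal (f z)"] by simp
qed

lemma integrable_lborel_bounded:
  fixes f :: "'a::euclidean_space \<Rightarrow> real"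
  assumes [measurable]: "f \<in> borel_measurable borel"
    and "\<And>z. \<bar>f z\<bar> \<le> B" "\<And>z. z \<notin> ball 0 r \<Longrightarrow> f z = 0"
  shows "integrable lborel f"
  by (rule integrableI_bounded_set[where A = "ball 0 r" and B = B])
     (use assms emeasure_bounded_finite[of "ball 0 r"] in auto)

section \<open>A bump function with quadratically controlled increments\<close>

text \<open>Squaring the positive part gives a Lipschitz gradient, so increments are linear up to an
  error \<open>O(|u|^2)\<close>, and the linear coefficient is explicit.\<close>

definition bump :: "real \<Rightarrow> complex \<Rightarrow> real" where
  "bump \<rho> z = (max 0 (1 - (cmod z)\<^sup>2 / \<rho>\<^sup>2))\<^sup>2"

lemma bump_measurable [measurable]: "bump \<rho> \<in> borel_measurable borel"
  unfolding bump_def by measurable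

lemma bump_nonneg: "0 \<le> bump \<rho> z"
  by (simp add: bump_def)

lemma bump_le_1: "bump \<rho> z \<le> 1"
  by (auto simp: bump_def max_def intro: power_le_one)

lemma bump_eq_0: "0 < \<rho> \<Longrightarrow> \<rho> \<le> cmod z \<Longrightarrow> bump \<rho> z = 0"
  by (simp add: bump_def max_def power_mono field_simps)

lemma bump_ge:
  assumes "0 < \<rho>" "cmod z < \<rho> / 2"
  shows "1 / 2 \<le> bump \<rho> z"
proof -
  have "(cmod z)\<^sup>2 \<le> (\<rho> / 2)\<^sup>2" using assms by (intro power_mono) auto
  hence "(cmod z)\<^sup>2 / \<rho>\<^sup>2 \<le> 1 / 4"
    using assms by (simp add: power_divide divide_le_eq)
  hence 34: "(3/4 :: real) \<le> max 0 (1 - (cmod z)\<^sup>2 / \<rho>\<^sup>2)"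
    by linarith
  have "(3/4)\<^sup>2 \<le> bump \<rho> z"
    unfolding bump_def by (rule power_mono[OF 34]) simp
  thus ?thesis by (simp add: power2_eq_square)
qed

text \<open>Taylor's bound for the square of the positive part, whose second derivative is 0 or 2
  away from the origin.\<close>

lemma square_pos_part_le:
  fixes a b :: real
  shows "(max 0 b)\<^sup>2 \<le> (max 0 a)\<^sup>2 + 2 * max 0 a * (b - a) + (b - a)\<^sup>2"
proof -
  have "0 \<le> a \<Longrightarrow> b \<le> 0 \<Longrightarrow> 0 \<le> a\<^sup>2 + 2 * a * (b - a) + (b - a)\<^sup>2"
    using zero_le_power2[of b] by (simp add: power2_eq_square algebra_simps)
  moreover have "a \<le> 0 \<Longrightarrow> 0 \<le> b \<Longrightarrow> b\<^sup>2 \<le> (b - a)\<^sup>2"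
    by (intro power_mono) auto
  moreover have "a \<le> 0 \<Longrightarrow> b \<le> 0 \<Longrightarrow> 0 \<le> (b - a)\<^sup>2"
    by simp
  ultimately show ?thesis
    by (cases "0 \<le> a"; cases "0 \<le> b") (auto simp: max_def power2_eq_square algebra_simps)
qed

text \<open>This is \<open>square_pos_part_le\<close> at \<open>a = 1 - |z|^2/\<rho>^2\<close> and
  its counterpart \<open>b\<close> at \<open>z - u\<close>. The \<open>-|u|^2\<close> in
  \<open>b - a\<close> has a favourable sign and is dropped from the first-order term, which thus
  stays exactly linear in \<open>u\<close> and can cancel by symmetry.\<close>

lemma bump_diff_le:
  assumes "0 < \<rho>" "cmod z \<le> R" "cmod u \<le> \<rho>"
  shows "bump \<rho> (z - u) - bump \<rho> z
      \<le> (4 * max 0 (1 - (cmod z)\<^sup>2 / \<rho>\<^sup>2) / \<rho>\<^sup>2) * (z \<bullet> u) + (2 * R + \<rho>)\<^sup>2 / \<rho>^4 * (cmod u)\<^sup>2"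
proof -
  define a b where "a = 1 - (cmod z)\<^sup>2 / \<rho>\<^sup>2" and "b = 1 - (cmod (z - u))\<^sup>2 / \<rho>\<^sup>2"
  have ba: "b - a = (2 * (z \<bullet> u) - (cmod u)\<^sup>2) / \<rho>\<^sup>2"
    using assms(1) unfolding a_def b_def power2_norm_eq_inner
    by (simp add: field_simps inner_diff inner_commute)
  have "2 * max 0 a * (b - a) \<le> 4 * max 0 a / \<rho>\<^sup>2 * (z \<bullet> u)"
  proof -
    have "2 * max 0 a * (b - a) = 4 * max 0 a / \<rho>\<^sup>2 * (z \<bullet> u) - 2 * max 0 a * (cmod u)\<^sup>2 / \<rho>\<^sup>2"
      using assms(1) unfolding ba by (simp add: field_simps)
    thus ?thesis by simp
  qed
  moreover have "(b - a)\<^sup>2 \<le> (2 * R + \<rho>)\<^sup>2 / \<rho>^4 * (cmod u)\<^sup>2"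
  proof -
    have "\<bar>2 * (z \<bullet> u) - (cmod u)\<^sup>2\<bar> \<le> 2 * (cmod z * cmod u) + cmod u * cmod u"
      using Cauchy_Schwarz_ineq2[of z u] zero_le_power2[of "cmod u"]
      unfolding power2_eq_square abs_le_iff by linarith
    also have "\<dots> = (2 * cmod z + cmod u) * cmod u" by (simp add: algebra_simps)
    also have "\<dots> \<le> (2 * R + \<rho>) * cmod u"
      using assms by (intro mult_right_mono) auto
    finally have "(2 * (z \<bullet> u) - (cmod u)\<^sup>2)\<^sup>2 \<le> ((2 * R + \<rho>) * cmod u)\<^sup>2"
      by (metis abs_ge_zero power2_abs power_mono)
    thus ?thesis
      using assms(1) unfolding ba
      by (simp add: power_divide power_mult_distrib divide_right_mono flip: power_mult)
  qed
  ultimately show ?thesis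
    using square_pos_part_le[of b a] unfolding bump_def a_def[symmetric] b_def[symmetric] by linarith
qed

section \<open>Energy of functions with the sub-mean value property\<close>

text \<open>The properties of \<open>exp (V - H)\<close> used by the estimates, free of extended
  reals. The value 0 outside the disk gives integrals over the whole plane; the mean value
  inequality is claimed only for disks inside, as it may fail across the boundary circle.\<close>

locale bounded_submean =
  fixes f :: "complex \<Rightarrow> real" and R M :: real
  assumes measurable_f [measurable]: "f \<in> borel_measurable borel"
    and nonneg: "0 \<le> f z"
    and bounded: "f z \<le> M"
    and zero_outside: "z \<notin> ball 0 R \<Longrightarrow> f z = 0"
    and usc: "z \<in> ball 0 R \<Longrightarrow> 0 < e \<Longrightarrow> \<forall>\<^sub>F w in nhds z. f w < f z + e"
    and submean: "0 < r \<Longrightarrow> cball z r \<subseteq> ball 0 R \<Longrightarrow>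
      f z * measure lborel (ball (0::complex) r) \<le> (\<integral>u. f (z + u) * indicator (ball 0 r) u \<partial>lborel)"
begin

lemma M_nonneg: "0 \<le> M"
  using nonneg[of 0] bounded[of 0] by linarith

lemma square_bounded: "(f z)\<^sup>2 \<le> M\<^sup>2"
  using nonneg bounded by (intro power_mono) auto

lemma integrable_on_ball:
  assumes [measurable]: "g \<in> borel_measurable borel" and "\<And>z. \<bar>g z\<bar> \<le> B"
  shows "integrable lborel (\<lambda>u. g u * indicator (ball (0::complex) r) u :: real)"
proof (rule integrable_lborel_bounded)
  have "0 \<le> B" using assms(2)[of undefined] by linarith
  thus "\<bar>g z * indicator (ball 0 r) z\<bar> \<le> B" for z
    using assms(2) by (auto simp: indicator_def)
qed (auto simp: indicator_def)

lemma integral_square_diff_le: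
  assumes "0 < r" "cball z r \<subseteq> ball 0 R"
  shows "(\<integral>u. (f (z + u) - f z)\<^sup>2 * indicator (ball 0 r) u \<partial>lborel)
    \<le> (\<integral>u. ((f (z + u))\<^sup>2 - (f z)\<^sup>2) * indicator (ball 0 r) u \<partial>lborel)"
proof -
  have b: "\<bar>f x - f y\<bar> \<le> M" "\<bar>(f x)\<^sup>2 - (f y)\<^sup>2\<bar> \<le> M\<^sup>2" for x y
    using nonneg[of x] nonneg[of y] bounded[of x] bounded[of y] square_bounded[of x] square_bounded[of y]
      zero_le_power2[of "f x"] zero_le_power2[of "f y"] by linarith+
  have i1: "integrable lborel (\<lambda>u. (f (z + u) - f z) * indicator (ball 0 r) u)"
    by (rule integrable_on_ball[where B = M]) (use b in auto)
  have i2: "integrable lborel (\<lambda>u. ((f (z + u))\<^sup>2 - (f z)\<^sup>2) * indicator (ball 0 r) u)"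
    by (rule integrable_on_ball[where B = "M\<^sup>2"]) (use b in auto)
  have i3: "integrable lborel (\<lambda>u. f (z + u) * indicator (ball 0 r) u)"
    by (rule integrable_on_ball[where B = M]) (use nonneg bounded in auto)
  have i4: "integrable lborel (\<lambda>u. f z * indicator (ball (0::complex) r) u)"
    by (rule integrable_on_ball[of "\<lambda>_. f z" M]) (use nonneg bounded in auto)
  have "(\<integral>u. (f (z + u) - f z)\<^sup>2 * indicator (ball 0 r) u \<partial>lborel)
      = (\<integral>u. ((f (z + u))\<^sup>2 - (f z)\<^sup>2) * indicator (ball 0 r) u
          - 2 * f z * ((f (z + u) - f z) * indicator (ball 0 r) u) \<partial>lborel)"
    by (intro Bochner_Integration.integral_cong) (auto simp: power2_eq_square algebra_simps)
  also have "\<dots> = (\<integral>u. ((f (z + u))\<^sup>2 - (f z)\<^sup>2) * indicator (ball 0 r) u \<partial>lborel)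
      - 2 * f z * (\<integral>u. (f (z + u) - f z) * indicator (ball 0 r) u \<partial>lborel)"
    by (subst Bochner_Integration.integral_diff[OF i2 integrable_mult_right[OF i1]]) simp
  also have "(\<integral>u. (f (z + u) - f z) * indicator (ball 0 r) u \<partial>lborel)
      = (\<integral>u. f (z + u) * indicator (ball 0 r) u \<partial>lborel) - (\<integral>u. f z * indicator (ball (0::complex) r) u \<partial>lborel)"
    by (subst Bochner_Integration.integral_diff[OF i3 i4, symmetric]) (simp add: left_diff_distrib)
  also have "(\<integral>u. f z * indicator (ball (0::complex) r) u \<partial>lborel) = f z * measure lborel (ball (0::complex) r)"
    by simp
  finally show ?thesis
    using submean[OF assms] nonneg[of z] by (simp add: mult_left_mono)
qed

text \<open>A discrete integration by parts: translation moves the increment from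
  \<open>f^2\<close>, for which no smoothness is at hand, to the bump, where
  \<open>bump_diff_le\<close> applies. The first-order term becomes a fixed vector paired with
  \<open>u\<close>.\<close>

lemma integral_bump_square_diff_le:
  fixes u :: complex
  assumes "0 < \<rho>" "cmod u \<le> \<rho>"
  shows "(\<integral>z. bump \<rho> z * ((f (z + u))\<^sup>2 - (f z)\<^sup>2) \<partial>lborel)
    \<le> (\<integral>z. ((f z)\<^sup>2 * (4 * max 0 (1 - (cmod z)\<^sup>2 / \<rho>\<^sup>2) / \<rho>\<^sup>2)) *\<^sub>R z \<partial>lborel) \<bullet> u
      + (2 * R + \<rho>)\<^sup>2 / \<rho>^4 * (\<integral>z. (f z)\<^sup>2 \<partial>lborel) * (cmod u)\<^sup>2"
proof -
  define v where "v z = ((f z)\<^sup>2 * (4 * max 0 (1 - (cmod z)\<^sup>2 / \<rho>\<^sup>2) / \<rho>\<^sup>2)) *\<^sub>R z" for z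
  have [measurable]: "v \<in> borel_measurable borel" unfolding v_def by measurable
  have zero: "f z = 0" if "R \<le> cmod z" for z using zero_outside[of z] that by auto
  have bb: "\<bar>bump \<rho> x * (f y)\<^sup>2\<bar> \<le> 1 * M\<^sup>2" for x y
    using bump_nonneg[of \<rho>] bump_le_1 square_bounded M_nonneg
    by (subst abs_mult, intro mult_mono) auto
  have i1: "integrable lborel (\<lambda>z. bump \<rho> z * (f (z + u))\<^sup>2)"
    by (rule integrable_lborel_bounded[where B = "1 * M\<^sup>2" and r = \<rho>])
       (use bb bump_eq_0[OF assms(1)] in auto)
  have i2: "integrable lborel (\<lambda>z. bump \<rho> z * (f z)\<^sup>2)"
    by (rule integrable_lborel_bounded[where B = "1 * M\<^sup>2" and r = \<rho>])
       (use bb bump_eq_0[OF assms(1)] in auto)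
  have i3: "integrable lborel (\<lambda>z. bump \<rho> (z - u) * (f z)\<^sup>2)"
    by (rule integrable_lborel_bounded[where B = "1 * M\<^sup>2" and r = R])
       (use bb zero in auto)
  have i4: "integrable lborel (\<lambda>z. (f z)\<^sup>2)"
    by (rule integrable_lborel_bounded[where B = "M\<^sup>2" and r = R])
       (use square_bounded zero in auto)
  have i5: "integrable lborel v"
  proof (rule integrableI_bounded_set[where A = "ball 0 R" and B = "M\<^sup>2 * (4 / \<rho>\<^sup>2) * \<bar>R\<bar>"])
    show "AE x in lborel. x \<in> ball 0 R \<longrightarrow> norm (v x) \<le> M\<^sup>2 * (4 / \<rho>\<^sup>2) * \<bar>R\<bar>"
    proof (intro AE_I2 impI)
      fix x :: complex assume "x \<in> ball 0 R"
      hence "(f x)\<^sup>2 * (4 * max 0 (1 - (cmod x)\<^sup>2 / \<rho>\<^sup>2) / \<rho>\<^sup>2) * cmod x \<le> M\<^sup>2 * (4 / \<rho>\<^sup>2) * \<bar>R\<bar>"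
        using square_bounded[of x] by (intro mult_mono divide_right_mono) auto
      thus "norm (v x) \<le> M\<^sup>2 * (4 / \<rho>\<^sup>2) * \<bar>R\<bar>" by (simp add: v_def abs_mult)
    qed
  qed (use emeasure_bounded_finite[of "ball (0::complex) R"] zero in \<open>auto simp: v_def\<close>)
  have "(\<integral>z. bump \<rho> z * ((f (z + u))\<^sup>2 - (f z)\<^sup>2) \<partial>lborel)
      = (\<integral>z. bump \<rho> z * (f (z + u))\<^sup>2 \<partial>lborel) - (\<integral>z. bump \<rho> z * (f z)\<^sup>2 \<partial>lborel)"
    by (subst Bochner_Integration.integral_diff[OF i1 i2, symmetric]) (simp add: algebra_simps)
  also have "(\<integral>z. bump \<rho> z * (f (z + u))\<^sup>2 \<partial>lborel) = (\<integral>z. bump \<rho> (z - u) * (f z)\<^sup>2 \<partial>lborel)"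
    using integral_lborel_translation[of "\<lambda>z. bump \<rho> (z - u) * (f z)\<^sup>2" u] by simp
  also have "\<dots> - (\<integral>z. bump \<rho> z * (f z)\<^sup>2 \<partial>lborel)
      = (\<integral>z. (bump \<rho> (z - u) - bump \<rho> z) * (f z)\<^sup>2 \<partial>lborel)"
    by (subst Bochner_Integration.integral_diff[OF i3 i2, symmetric]) (simp add: algebra_simps)
  also have "\<dots> \<le> (\<integral>z. v z \<bullet> u + (2 * R + \<rho>)\<^sup>2 / \<rho>^4 * (cmod u)\<^sup>2 * (f z)\<^sup>2 \<partial>lborel)"
  proof (rule integral_mono)
    show "integrable lborel (\<lambda>z. (bump \<rho> (z - u) - bump \<rho> z) * (f z)\<^sup>2)"
      using Bochner_Integration.integrable_diff[OF i3 i2] by (simp add: algebra_simps)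
    show "integrable lborel (\<lambda>z. v z \<bullet> u + (2 * R + \<rho>)\<^sup>2 / \<rho>^4 * (cmod u)\<^sup>2 * (f z)\<^sup>2)"
      using i4 i5 by auto
    fix z
    show "(bump \<rho> (z - u) - bump \<rho> z) * (f z)\<^sup>2
        \<le> v z \<bullet> u + (2 * R + \<rho>)\<^sup>2 / \<rho>^4 * (cmod u)\<^sup>2 * (f z)\<^sup>2"
    proof (cases "cmod z \<le> R")
      case True
      show ?thesis
        using mult_right_mono[OF bump_diff_le[OF assms(1) True assms(2)], of "(f z)\<^sup>2"]
        by (simp add: v_def algebra_simps)
    qed (use zero[of z] in \<open>simp add: v_def\<close>)
  qed
  also have "\<dots> = (\<integral>z. v z \<bullet> u \<partial>lborel) + (\<integral>z. (2 * R + \<rho>)\<^sup>2 / \<rho>^4 * (cmod u)\<^sup>2 * (f z)\<^sup>2 \<partial>lborel)"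
    using i4 i5 by (intro Bochner_Integration.integral_add) auto
  also have "(\<integral>z. v z \<bullet> u \<partial>lborel) = (\<integral>z. v z \<partial>lborel) \<bullet> u"
    using i5 by simp
  finally show ?thesis
    by (simp add: v_def mult_ac)
qed

text \<open>Fubini makes the integral over \<open>u\<close> the outer one. The first-order term is
  then linear in \<open>u\<close> and vanishes over the disk by oddness, which leaves the quadratic
  remainder. The condition \<open>2 * \<rho> \<le> R\<close> keeps all disks about points where the
  bump is positive inside the domain.\<close>

lemma energy_disk:
  assumes "0 < \<rho>" "2 * \<rho> \<le> R"
  obtains K where "0 \<le> K" "\<And>r. 0 < r \<Longrightarrow> r \<le> \<rho> \<Longrightarrow>
    (\<integral>z. bump \<rho> z * (\<integral>u. (f (z + u) - f z)\<^sup>2 * indicator (ball 0 r) u \<partial>lborel) \<partial>lborel)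
      \<le> K * r\<^sup>2 * measure lborel (ball (0::complex) r)"
proof
  let ?I = "\<integral>z. (f z)\<^sup>2 \<partial>lborel"
  let ?K = "(2 * R + \<rho>)\<^sup>2 / \<rho>^4 * ?I"
  let ?v = "\<integral>z. ((f z)\<^sup>2 * (4 * max 0 (1 - (cmod z)\<^sup>2 / \<rho>\<^sup>2) / \<rho>\<^sup>2)) *\<^sub>R z \<partial>lborel"
  show K: "0 \<le> ?K" using assms by (intro mult_nonneg_nonneg) auto
  fix r assume r: "0 < r" "r \<le> \<rho>"
  have b: "\<bar>f x - f y\<bar> \<le> M" "\<bar>(f x)\<^sup>2 - (f y)\<^sup>2\<bar> \<le> M\<^sup>2" for x y
    using nonneg[of x] nonneg[of y] bounded[of x] bounded[of y] square_bounded[of x] square_bounded[of y]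
      zero_le_power2[of "f x"] zero_le_power2[of "f y"] by linarith+
  have b2: "\<bar>(f x - f y)\<^sup>2\<bar> \<le> M\<^sup>2" for x y
    using power_mono[OF b(1), of x y 2] by simp
  have sub: "cball z r \<subseteq> ball 0 R" if "cmod z < \<rho>" for z
  proof
    fix w assume "w \<in> cball z r"
    hence "cmod w \<le> cmod z + r" using norm_triangle_ineq4[of z "z - w"] by (simp add: dist_norm)
    thus "w \<in> ball 0 R" using that r assms by simp
  qed
  have fin: "emeasure (lborel \<Otimes>\<^sub>M lborel) (ball (0::complex) \<rho> \<times> ball (0::complex) r) < \<infinity>"
    using emeasure_bounded_finite[of "ball (0::complex) \<rho>"] emeasure_bounded_finite[of "ball (0::complex) r"]
    by (subst lborel.emeasure_pair_measure_Times) (auto simp: ennreal_mult_less_top)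
  have prod_int: "integrable (lborel \<Otimes>\<^sub>M lborel) (\<lambda>(z, u). bump \<rho> z * (g z u * indicator (ball 0 r) u))"
    if [measurable]: "case_prod g \<in> borel_measurable (borel \<Otimes>\<^sub>M borel)"
      and "\<And>z u. \<bar>g z u\<bar> \<le> M\<^sup>2" for g :: "complex \<Rightarrow> complex \<Rightarrow> real"
  proof (rule integrableI_bounded_set[OF _ _ fin])
    show "AE x in lborel \<Otimes>\<^sub>M lborel. x \<in> ball 0 \<rho> \<times> ball 0 r \<longrightarrow>
        norm (case x of (z, u) \<Rightarrow> bump \<rho> z * (g z u * indicator (ball 0 r) u)) \<le> 1 * (M\<^sup>2 * 1)"
    proof (intro AE_I2 impI)
      fix x :: "complex \<times> complex"
      have "\<bar>bump \<rho> (fst x)\<bar> * (\<bar>g (fst x) (snd x)\<bar> * \<bar>indicator (ball 0 r) (snd x)\<bar>) \<le> 1 * (M\<^sup>2 * 1)"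
        using that bump_nonneg[of \<rho>] bump_le_1[of \<rho>] by (intro mult_mono) (auto simp: indicator_def)
      thus "norm (case x of (z, u) \<Rightarrow> bump \<rho> z * (g z u * indicator (ball 0 r) u)) \<le> 1 * (M\<^sup>2 * 1)"
        by (simp add: case_prod_beta abs_mult)
    qed
    show "AE x in lborel \<Otimes>\<^sub>M lborel. x \<notin> ball 0 \<rho> \<times> ball 0 r \<longrightarrow>
        (case x of (z, u) \<Rightarrow> bump \<rho> z * (g z u * indicator (ball 0 r) u)) = 0"
      using bump_eq_0[OF assms(1)] by (intro AE_I2) (auto simp: indicator_def, meson not_less)
  qed auto
  note p1 = prod_int[of "\<lambda>z u. (f (z + u) - f z)\<^sup>2", OF _ b2]
  note p2 = prod_int[of "\<lambda>z u. (f (z + u))\<^sup>2 - (f z)\<^sup>2", OF _ b(2)]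
  have lin: "integrable lborel (\<lambda>u. (?v \<bullet> u) * indicator (ball 0 r) u)"
  proof (rule integrable_lborel_bounded[where B = "norm ?v * r" and r = r])
    fix u :: complex
    show "\<bar>?v \<bullet> u * indicator (ball 0 r) u\<bar> \<le> norm ?v * r"
    proof (cases "u \<in> ball 0 r")
      case True
      hence "norm ?v * cmod u \<le> norm ?v * r" by (intro mult_left_mono) auto
      thus ?thesis using Cauchy_Schwarz_ineq2[of ?v u] True by simp
    qed (use r in simp)
  qed auto
  have const: "integrable lborel (\<lambda>u. ?K * r\<^sup>2 * indicator (ball (0::complex) r) u)"
    by (rule integrable_on_ball[of "\<lambda>_. ?K * r\<^sup>2" "\<bar>?K * r\<^sup>2\<bar>"]) auto
  have "(\<integral>z. bump \<rho> z * (\<integral>u. (f (z + u) - f z)\<^sup>2 * indicator (ball 0 r) u \<partial>lborel) \<partial>lborel)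
      \<le> (\<integral>z. bump \<rho> z * (\<integral>u. ((f (z + u))\<^sup>2 - (f z)\<^sup>2) * indicator (ball 0 r) u \<partial>lborel) \<partial>lborel)"
  proof (rule integral_mono)
    show "integrable lborel (\<lambda>z. bump \<rho> z * (\<integral>u. (f (z + u) - f z)\<^sup>2 * indicator (ball 0 r) u \<partial>lborel))"
      using lborel_pair.integrable_fst[OF p1] by simp
    show "integrable lborel (\<lambda>z. bump \<rho> z * (\<integral>u. ((f (z + u))\<^sup>2 - (f z)\<^sup>2) * indicator (ball 0 r) u \<partial>lborel))"
      using lborel_pair.integrable_fst[OF p2] by simp
    fix z :: complex
    show "bump \<rho> z * (\<integral>u. (f (z + u) - f z)\<^sup>2 * indicator (ball 0 r) u \<partial>lborel)
      \<le> bump \<rho> z * (\<integral>u. ((f (z + u))\<^sup>2 - (f z)\<^sup>2) * indicator (ball 0 r) u \<partial>lborel)"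
    proof (cases "cmod z < \<rho>")
      case True
      thus ?thesis by (intro mult_left_mono integral_square_diff_le r sub bump_nonneg)
    qed (use bump_eq_0[OF assms(1), of z] in simp)
  qed
  also have "\<dots> = (\<integral>z. \<integral>u. bump \<rho> z * (((f (z + u))\<^sup>2 - (f z)\<^sup>2) * indicator (ball 0 r) u) \<partial>lborel \<partial>lborel)"
    by simp
  also have "\<dots> = (\<integral>u. \<integral>z. bump \<rho> z * (((f (z + u))\<^sup>2 - (f z)\<^sup>2) * indicator (ball 0 r) u) \<partial>lborel \<partial>lborel)"
    by (rule lborel_pair.Fubini_integral[symmetric], rule p2) simp
  also have "\<dots> \<le> (\<integral>u. (?v \<bullet> u) * indicator (ball 0 r) u + ?K * r\<^sup>2 * indicator (ball 0 r) u \<partial>lborel)"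
  proof (rule integral_mono)
    show "integrable lborel (\<lambda>u. \<integral>z. bump \<rho> z * (((f (z + u))\<^sup>2 - (f z)\<^sup>2) * indicator (ball 0 r) u) \<partial>lborel)"
      using lborel_pair.integrable_snd[OF p2] by simp
    show "integrable lborel (\<lambda>u. (?v \<bullet> u) * indicator (ball 0 r) u + ?K * r\<^sup>2 * indicator (ball 0 r) u)"
      by (rule Bochner_Integration.integrable_add[OF lin const])
    fix u :: complex
    show "(\<integral>z. bump \<rho> z * (((f (z + u))\<^sup>2 - (f z)\<^sup>2) * indicator (ball 0 r) u) \<partial>lborel)
        \<le> (?v \<bullet> u) * indicator (ball 0 r) u + ?K * r\<^sup>2 * indicator (ball 0 r) u"
    proof (cases "u \<in> ball 0 r")
      case True
      hence u: "cmod u \<le> \<rho>" "cmod u \<le> r" using r by auto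
      have "?K * (cmod u)\<^sup>2 \<le> ?K * r\<^sup>2"
        using K u by (intro mult_left_mono power_mono) auto
      thus ?thesis
        using integral_bump_square_diff_le[OF assms(1) u(1)] True by simp
    qed simp
  qed
  also have "\<dots> = (\<integral>u. (?v \<bullet> u) * indicator (ball 0 r) u \<partial>lborel) + (\<integral>u. ?K * r\<^sup>2 * indicator (ball (0::complex) r) u \<partial>lborel)"
    by (rule Bochner_Integration.integral_add[OF lin const])
  also have "(\<integral>u. (?v \<bullet> u) * indicator (ball 0 r) u \<partial>lborel) = 0"
    by (rule integral_lborel_odd[OF _ lin]) (auto simp: indicator_def)
  also have "(\<integral>u. ?K * r\<^sup>2 * indicator (ball (0::complex) r) u \<partial>lborel) = ?K * r\<^sup>2 * measure lborel (ball (0::complex) r)"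
    by simp
  finally show "(\<integral>z. bump \<rho> z * (\<integral>u. (f (z + u) - f z)\<^sup>2 * indicator (ball 0 r) u \<partial>lborel) \<partial>lborel)
      \<le> ?K * r\<^sup>2 * measure lborel (ball (0::complex) r)" by simp
qed

end


lemma AE_lborel_open_ex:
  fixes U :: "'a::euclidean_space set"
  assumes "AE x in lborel. P x" "open U" "U \<noteq> {}"
  obtains x where "x \<in> U" "P x"
proof -
  have False if "\<And>x. x \<in> U \<Longrightarrow> \<not> P x"
  proof -
    have "AE x in lborel. x \<notin> U" using assms(1) that by (auto elim: eventually_mono)
    hence U: "U \<in> null_sets lborel" using assms(2) by (subst AE_iff_null_sets) auto
    obtain p d where "0 < d" "ball p d \<subseteq> U" using assms(2,3) open_contains_ball by blast
    hence "ball p d \<in> null_sets lborel" using U by (intro null_sets_subset[OF U]) auto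
    hence "measure lborel (ball p d) = 0" by (simp add: measure_def null_setsD1)
    thus False using \<open>0 < d\<close> by simp
  qed
  thus thesis using that by blast
qed

section \<open>From averaged energy to pointwise monotonicity\<close>

context bounded_submean
begin

text \<open>Every \<open>u\<close> in the disk of radius \<open>|h|/2\<close> about
  \<open>h/2\<close> is within \<open>|h|\<close> of both 0 and \<open>h\<close>. Passing through
  \<open>z + u\<close> splits \<open>f(z+h) - f(z)\<close> into two differences controlled by the
  disk energies at \<open>z\<close> and \<open>z + h\<close>; averaging over \<open>u\<close> gives
  the bound for the single shift.\<close>

lemma energy_shift:
  assumes "0 < \<rho>" "2 * \<rho> \<le> R"
  obtains K where "0 \<le> K" "\<And>h. h \<noteq> 0 \<Longrightarrow> cmod h \<le> \<rho> / 4 \<Longrightarrow>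
    (\<integral>\<^sup>+z. ennreal ((f (z + h) - f z)\<^sup>2) * indicator (ball 0 (\<rho> / 4)) z \<partial>lborel) \<le> ennreal (K * (cmod h)\<^sup>2)"
proof -
  obtain K where K: "0 \<le> K" "\<And>r. 0 < r \<Longrightarrow> r \<le> \<rho> \<Longrightarrow>
    (\<integral>z. bump \<rho> z * (\<integral>u. (f (z + u) - f z)\<^sup>2 * indicator (ball 0 r) u \<partial>lborel) \<partial>lborel)
      \<le> K * r\<^sup>2 * measure lborel (ball (0::complex) r)"
    using energy_disk[OF assms] by blast
  show thesis
  proof
    \<comment> \<open>The factor is 2 * 4 * 4: the bump is only known to be at least 1/2, the disk
      of radius \<open>|h|\<close> has four times the area of the one of radius
      \<open>|h|/2\<close>, and the two energies enter with weight 2 each, from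
      \<open>(x + y)^2 \<le> 2 x^2 + 2 y^2\<close>.\<close>
    show "0 \<le> 32 * K" using K(1) by simp
    fix h :: complex assume h: "h \<noteq> 0" "cmod h \<le> \<rho> / 4"
    define r where "r = cmod h"
    have r: "0 < r" "r \<le> \<rho>" "r \<le> \<rho> / 4" using h assms by (auto simp: r_def)
    define \<Phi> where "\<Phi> z = (\<integral>\<^sup>+u. ennreal ((f (z + u) - f z)\<^sup>2) * indicator (ball 0 r) u \<partial>lborel)" for z
    define \<Psi> where "\<Psi> z = (\<integral>u. (f (z + u) - f z)\<^sup>2 * indicator (ball 0 r) u \<partial>lborel)" for z
    have [measurable]: "\<Phi> \<in> borel_measurable borel" "\<Psi> \<in> borel_measurable borel"
      unfolding \<Phi>_def \<Psi>_def by measurable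
    have b: "\<bar>f x - f y\<bar> \<le> M" for x y
      using nonneg[of x] nonneg[of y] bounded[of x] bounded[of y] by linarith
    have b2: "\<bar>(f x - f y)\<^sup>2\<bar> \<le> M\<^sup>2" for x y
      using power_mono[OF b, of x y 2] by simp
    have int\<Psi>: "integrable lborel (\<lambda>u. (f (z + u) - f z)\<^sup>2 * indicator (ball 0 r) u)" for z
      by (rule integrable_on_ball[where B = "M\<^sup>2"]) (use b2 in auto)
    have \<Phi>\<Psi>: "\<Phi> z = ennreal (\<Psi> z)" for z
      unfolding \<Phi>_def \<Psi>_def
      by (subst nn_integral_eq_integral[symmetric, OF int\<Psi>])
         (auto intro!: nn_integral_cong simp: ennreal_mult ennreal_indicator[symmetric])
    have \<Psi>0: "0 \<le> \<Psi> z" for z unfolding \<Psi>_def by (intro Bochner_Integration.integral_nonneg) auto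
    have \<Psi>_le: "\<Psi> z \<le> M\<^sup>2 * measure lborel (ball (0::complex) r)" for z
    proof -
      have "\<Psi> z \<le> (\<integral>u. M\<^sup>2 * indicator (ball (0::complex) r) u \<partial>lborel)"
        unfolding \<Psi>_def
        by (intro integral_mono int\<Psi> integrable_on_ball[of "\<lambda>_. M\<^sup>2" "M\<^sup>2"] mult_right_mono)
           (use b2 in auto)
      thus ?thesis by simp
    qed
    have int: "integrable lborel (\<lambda>z. bump \<rho> z * \<Psi> z)"
    proof (rule integrable_lborel_bounded)
      show "\<bar>bump \<rho> z * \<Psi> z\<bar> \<le> 1 * (M\<^sup>2 * measure lborel (ball (0::complex) r))" for z
        using \<Psi>0 \<Psi>_le bump_nonneg[of \<rho>] bump_le_1[of \<rho>] by (subst abs_mult, intro mult_mono) auto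
      show "bump \<rho> z * \<Psi> z = 0" if "z \<notin> ball 0 \<rho>" for z
        using bump_eq_0[OF assms(1), of z] that by simp
    qed auto
    have "(\<integral>\<^sup>+z. \<Phi> z * indicator (ball 0 (\<rho> / 2)) z \<partial>lborel) \<le> (\<integral>\<^sup>+z. ennreal (2 * (bump \<rho> z * \<Psi> z)) \<partial>lborel)"
    proof (intro nn_integral_mono)
      fix z
      show "\<Phi> z * indicator (ball 0 (\<rho> / 2)) z \<le> ennreal (2 * (bump \<rho> z * \<Psi> z))"
      proof (cases "z \<in> ball 0 (\<rho> / 2)")
        case True
        hence "1 * \<Psi> z \<le> (2 * bump \<rho> z) * \<Psi> z"
          using bump_ge[OF assms(1), of z] \<Psi>0 by (intro mult_right_mono) auto
        thus ?thesis using True by (simp add: \<Phi>\<Psi> ennreal_leI)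
      qed simp
    qed
    also have "\<dots> = ennreal (2 * (\<integral>z. bump \<rho> z * \<Psi> z \<partial>lborel))"
      by (subst nn_integral_eq_integral) (use int \<Psi>0 bump_nonneg in auto)
    also have "\<dots> \<le> ennreal (2 * (K * r\<^sup>2 * measure lborel (ball (0::complex) r)))"
      using K(2)[OF r(1,2)] unfolding \<Psi>_def by (intro ennreal_leI) simp
    finally have E: "(\<integral>\<^sup>+z. \<Phi> z * indicator (ball 0 (\<rho> / 2)) z \<partial>lborel)
        \<le> ennreal (2 * (K * r\<^sup>2 * measure lborel (ball (0::complex) r)))" .
    define m where "m = measure lborel (ball (0::complex) (r / 2))"
    have m: "0 < m" "measure lborel (ball (0::complex) r) = 4 * m"
      "emeasure lborel (ball (h / 2) (r / 2)) = ennreal m"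
    proof -
      show "0 < m" using r by (simp add: m_def)
      show "measure lborel (ball (0::complex) r) = 4 * m"
        using r by (simp add: m_def content_ball power2_eq_square)
      have "emeasure lborel (ball (h / 2) (r / 2)) = ennreal (measure lborel (ball (h / 2) (r / 2)))"
        using emeasure_bounded_finite[of "ball (h / 2) (r / 2)"] by (intro emeasure_eq_ennreal_measure) auto
      thus "emeasure lborel (ball (h / 2) (r / 2)) = ennreal m"
        using r by (simp add: m_def content_ball)
    qed
    have point: "ennreal m * ennreal ((f (z + h) - f z)\<^sup>2) \<le> 2 * \<Phi> z + 2 * \<Phi> (z + h)" for z
    proof -
      have "ennreal m * ennreal ((f (z + h) - f z)\<^sup>2)
          = (\<integral>\<^sup>+u. ennreal ((f (z + h) - f z)\<^sup>2) * indicator (ball (h / 2) (r / 2)) u \<partial>lborel)"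
        by (subst nn_integral_cmult_indicator) (auto simp: m(3) mult.commute)
      also have "\<dots> \<le> (\<integral>\<^sup>+u. 2 * (ennreal ((f (z + u) - f z)\<^sup>2) * indicator (ball 0 r) u)
          + 2 * (ennreal ((f (z + h + (u - h)) - f (z + h))\<^sup>2) * indicator (ball 0 r) (u - h)) \<partial>lborel)"
      proof (intro nn_integral_mono)
        fix u
        show "ennreal ((f (z + h) - f z)\<^sup>2) * indicator (ball (h / 2) (r / 2)) u
          \<le> 2 * (ennreal ((f (z + u) - f z)\<^sup>2) * indicator (ball 0 r) u)
          + 2 * (ennreal ((f (z + h + (u - h)) - f (z + h))\<^sup>2) * indicator (ball 0 r) (u - h))"
        proof (cases "u \<in> ball (h / 2) (r / 2)")
          case True
          hence "cmod (u - h / 2) < r / 2" by (simp add: dist_norm norm_minus_commute)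
          hence "cmod u < r" "cmod (u - h) < r"
            using norm_triangle_ineq[of "u - h / 2" "h / 2"] norm_triangle_ineq4[of "u - h / 2" "h / 2"] r
            by (auto simp: r_def norm_divide)
          moreover have "(f (z + h) - f z)\<^sup>2 \<le> 2 * (f (z + u) - f z)\<^sup>2 + 2 * (f (z + u) - f (z + h))\<^sup>2"
            using zero_le_power2[of "(f (z + h) - f (z + u)) - (f (z + u) - f z)"]
            by (simp add: power2_eq_square algebra_simps)
          hence "ennreal ((f (z + h) - f z)\<^sup>2)
              \<le> ennreal (2 * (f (z + u) - f z)\<^sup>2 + 2 * (f (z + u) - f (z + h))\<^sup>2)"
            by (rule ennreal_leI)
          ultimately show ?thesis using True by (simp add: ennreal_plus ennreal_mult)
        qed simp
      qed
      also have "\<dots> = 2 * \<Phi> z + 2 * (\<integral>\<^sup>+u. ennreal ((f (z + h + (u - h)) - f (z + h))\<^sup>2) * indicator (ball 0 r) (u - h) \<partial>lborel)"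
        unfolding \<Phi>_def by (subst nn_integral_add) (auto simp: nn_integral_cmult)
      also have "(\<integral>\<^sup>+u. ennreal ((f (z + h + (u - h)) - f (z + h))\<^sup>2) * indicator (ball 0 r) (u - h) \<partial>lborel) = \<Phi> (z + h)"
        using nn_integral_lborel_translation[of "\<lambda>u. ennreal ((f (z + h + u) - f (z + h))\<^sup>2) * indicator (ball 0 r) u" "-h"]
        unfolding \<Phi>_def by simp
      finally show ?thesis .
    qed
    have "ennreal m * (\<integral>\<^sup>+z. ennreal ((f (z + h) - f z)\<^sup>2) * indicator (ball 0 (\<rho> / 4)) z \<partial>lborel)
        = (\<integral>\<^sup>+z. ennreal m * ennreal ((f (z + h) - f z)\<^sup>2) * indicator (ball 0 (\<rho> / 4)) z \<partial>lborel)"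
      by (subst nn_integral_cmult[symmetric]) (auto simp: mult_ac)
    also have "\<dots> \<le> (\<integral>\<^sup>+z. 2 * (\<Phi> z * indicator (ball 0 (\<rho> / 2)) z)
        + 2 * (\<Phi> (z + h) * indicator (ball 0 (\<rho> / 2)) (z + h)) \<partial>lborel)"
    proof (intro nn_integral_mono)
      fix z
      show "ennreal m * ennreal ((f (z + h) - f z)\<^sup>2) * indicator (ball 0 (\<rho> / 4)) z
          \<le> 2 * (\<Phi> z * indicator (ball 0 (\<rho> / 2)) z) + 2 * (\<Phi> (z + h) * indicator (ball 0 (\<rho> / 2)) (z + h))"
      proof (cases "z \<in> ball 0 (\<rho> / 4)")
        case True
        hence "cmod z < \<rho> / 2" "cmod (z + h) < \<rho> / 2"
          using norm_triangle_ineq[of z h] h assms by auto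
        thus ?thesis using point[of z] True by simp
      qed simp
    qed
    also have "\<dots> = 2 * (\<integral>\<^sup>+z. \<Phi> z * indicator (ball 0 (\<rho> / 2)) z \<partial>lborel)
        + 2 * (\<integral>\<^sup>+z. \<Phi> (z + h) * indicator (ball 0 (\<rho> / 2)) (z + h) \<partial>lborel)"
      by (subst nn_integral_add) (auto simp: nn_integral_cmult)
    also have "(\<integral>\<^sup>+z. \<Phi> (z + h) * indicator (ball 0 (\<rho> / 2)) (z + h) \<partial>lborel)
        = (\<integral>\<^sup>+z. \<Phi> z * indicator (ball 0 (\<rho> / 2)) z \<partial>lborel)"
      by (rule nn_integral_lborel_translation[of "\<lambda>z. \<Phi> z * indicator (ball 0 (\<rho> / 2)) z"]) measurable
    also have "2 * (\<integral>\<^sup>+z. \<Phi> z * indicator (ball 0 (\<rho> / 2)) z \<partial>lborel)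
        + 2 * (\<integral>\<^sup>+z. \<Phi> z * indicator (ball 0 (\<rho> / 2)) z \<partial>lborel)
        = 4 * (\<integral>\<^sup>+z. \<Phi> z * indicator (ball 0 (\<rho> / 2)) z \<partial>lborel)"
      by (simp flip: distrib_right)
    also have "\<dots> \<le> ennreal 4 * ennreal (2 * (K * r\<^sup>2 * (4 * m)))"
      using E unfolding m(2) by (intro mult_mono) auto
    also have "\<dots> = ennreal m * ennreal (32 * K * r\<^sup>2)"
    proof -
      have "ennreal 4 * ennreal (2 * (K * r\<^sup>2 * (4 * m))) = ennreal (4 * (2 * (K * r\<^sup>2 * (4 * m))))"
        using K(1) m(1) by (intro ennreal_mult[symmetric]) auto
      also have "4 * (2 * (K * r\<^sup>2 * (4 * m))) = m * (32 * K * r\<^sup>2)" by simp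
      also have "ennreal \<dots> = ennreal m * ennreal (32 * K * r\<^sup>2)"
        using K(1) m(1) by (intro ennreal_mult) auto
      finally show ?thesis .
    qed
    finally show "(\<integral>\<^sup>+z. ennreal ((f (z + h) - f z)\<^sup>2) * indicator (ball 0 (\<rho> / 4)) z \<partial>lborel)
        \<le> ennreal (32 * K * (cmod h)\<^sup>2)"
      using m(1) unfolding r_def by (subst (asm) ennreal_mult_le_mult_iff) auto
  qed
qed

text \<open>Let \<open>x n\<close> be the positive part of the difference quotient with step
  \<open>h/(n+1)\<close>. Telescoping along the segment bounds the integrated increment by the
  integral of \<open>x n\<close>, and \<open>x n \<le> min (x n) L + (x n)^2 / L\<close>. The first
  term tends to 0 by dominated convergence, the second contributes at most
  \<open>K |h|^2 / L\<close> by \<open>energy_shift\<close>, and \<open>L\<close> is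
  arbitrary.\<close>

lemma integral_shift_le:
  assumes \<rho>: "0 < \<rho>" "2 * \<rho> \<le> R" and h: "cmod h \<le> \<rho> / 4"
    and deriv: "AE z in lborel. z \<in> ball 0 (\<rho> / 4) \<longrightarrow>
      (\<lambda>n. max 0 (real (Suc n) * (f (z + h /\<^sub>R real (Suc n)) - f z))) \<longlonglongrightarrow> 0"
    and sub: "\<And>t u. 0 \<le> t \<Longrightarrow> t \<le> 1 \<Longrightarrow> u \<in> ball 0 \<epsilon> \<Longrightarrow> a + t *\<^sub>R h + u \<in> ball 0 (\<rho> / 4)"
  shows "(\<integral>u. (f (a + h + u) - f (a + u)) * indicator (ball 0 \<epsilon>) u \<partial>lborel) \<le> 0" (is "?X \<le> 0")
proof (cases "h = 0")
  case False
  obtain K where K: "0 \<le> K" "\<And>h. h \<noteq> 0 \<Longrightarrow> cmod h \<le> \<rho> / 4 \<Longrightarrow>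
    (\<integral>\<^sup>+z. ennreal ((f (z + h) - f z)\<^sup>2) * indicator (ball 0 (\<rho> / 4)) z \<partial>lborel) \<le> ennreal (K * (cmod h)\<^sup>2)"
    using energy_shift[OF \<rho>] by blast
  define B where "B = ball (0::complex) (\<rho> / 4)"
  have [measurable]: "B \<in> sets borel" by (simp add: B_def)
  define x where "x n z = max 0 (real (Suc n) * (f (z + h /\<^sub>R real (Suc n)) - f z)) * indicator B z" for n z
  have [measurable]: "x n \<in> borel_measurable borel" for n unfolding x_def by measurable
  have x0: "0 \<le> x n z" for n z by (simp add: x_def)
  have xM: "x n z \<le> real (Suc n) * M" for n z
  proof -
    have "real (Suc n) * (f (z + h /\<^sub>R real (Suc n)) - f z) \<le> real (Suc n) * M"
      using nonneg[of z] bounded[of "z + h /\<^sub>R real (Suc n)"] by (intro mult_left_mono) auto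
    thus ?thesis using M_nonneg by (auto simp: x_def indicator_def)
  qed
  have xint: "integrable lborel (x n)" for n
    by (rule integrable_lborel_bounded[where B = "real (Suc n) * M" and r = "\<rho> / 4"])
       (use x0 xM in \<open>auto simp: abs_of_nonneg x_def B_def\<close>)
  have xsq_int: "integrable lborel (\<lambda>z. (x n z)\<^sup>2)" for n
  proof (rule integrable_lborel_bounded[where B = "(real (Suc n) * M)\<^sup>2" and r = "\<rho> / 4"])
    show "\<bar>(x n z)\<^sup>2\<bar> \<le> (real (Suc n) * M)\<^sup>2" for z
      using power_mono[OF xM x0, of n z 2] by simp
  qed (auto simp: x_def B_def)
  have xsq: "(\<integral>z. (x n z)\<^sup>2 \<partial>lborel) \<le> K * (cmod h)\<^sup>2" for n
  proof -
    define k where "k = h /\<^sub>R real (Suc n)"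
    have k: "k \<noteq> 0" "cmod k \<le> \<rho> / 4" "(real (Suc n))\<^sup>2 * (cmod k)\<^sup>2 = (cmod h)\<^sup>2"
    proof -
      have "inverse (real (Suc n)) * cmod h \<le> 1 * cmod h"
        by (intro mult_right_mono) (auto simp: inverse_le_1_iff)
      hence "cmod k \<le> cmod h" unfolding k_def by simp
      thus "cmod k \<le> \<rho> / 4" using h by simp
    qed (use False in \<open>auto simp: k_def field_simps power_mult_distrib\<close>)
    have "ennreal (\<integral>z. (x n z)\<^sup>2 \<partial>lborel) = (\<integral>\<^sup>+z. ennreal ((x n z)\<^sup>2) \<partial>lborel)"
      by (rule nn_integral_eq_integral[symmetric]) (use xsq_int in auto)
    also have "\<dots> \<le> (\<integral>\<^sup>+z. ennreal ((real (Suc n))\<^sup>2) * (ennreal ((f (z + k) - f z)\<^sup>2) * indicator B z) \<partial>lborel)"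
    proof (intro nn_integral_mono)
      fix z
      have "(max 0 y)\<^sup>2 \<le> y\<^sup>2" for y :: real by (auto simp: max_def)
      from this[of "real (Suc n) * (f (z + k) - f z)"]
      have "ennreal ((max 0 (real (Suc n) * (f (z + k) - f z)))\<^sup>2)
          \<le> ennreal ((real (Suc n))\<^sup>2 * (f (z + k) - f z)\<^sup>2)"
        by (intro ennreal_leI) (simp only: power_mult_distrib)
      thus "ennreal ((x n z)\<^sup>2) \<le> ennreal ((real (Suc n))\<^sup>2) * (ennreal ((f (z + k) - f z)\<^sup>2) * indicator B z)"
        by (auto simp: x_def k_def ennreal_mult indicator_def simp del: of_nat_Suc)
    qed
    also have "\<dots> = ennreal ((real (Suc n))\<^sup>2) * (\<integral>\<^sup>+z. ennreal ((f (z + k) - f z)\<^sup>2) * indicator B z \<partial>lborel)"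
      by (rule nn_integral_cmult) measurable
    also have "\<dots> \<le> ennreal ((real (Suc n))\<^sup>2) * ennreal (K * (cmod k)\<^sup>2)"
      using K(2)[OF k(1,2)] unfolding B_def by (intro mult_left_mono) auto
    also have "\<dots> = ennreal (K * ((real (Suc n))\<^sup>2 * (cmod k)\<^sup>2))"
      using K(1) by (subst ennreal_mult[symmetric]) (auto simp: mult_ac)
    finally show ?thesis unfolding k(3) using K(1) by (subst (asm) ennreal_le_iff) auto
  qed
  have X_le: "?X \<le> (\<integral>z. x n z \<partial>lborel)" for n
  proof -
    have step: "f (y + h /\<^sub>R real (Suc n)) - f y \<le> x n y / real (Suc n)" if "y \<in> B" for y
      using that by (simp add: x_def le_divide_eq mult.commute del: of_nat_Suc)
    have fi: "integrable lborel (\<lambda>u. (f (a + h + u) - f (a + u)) * indicator (ball 0 \<epsilon>) u)"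
    proof (rule integrable_on_ball[where B = M])
      show "\<bar>f (a + h + z) - f (a + z)\<bar> \<le> M" for z
        using nonneg[of "a + h + z"] nonneg[of "a + z"] bounded[of "a + h + z"] bounded[of "a + z"]
        by linarith
    qed auto
    \<comment> \<open>These points divide the segment from \<open>a\<close> to \<open>a + h\<close>
      into \<open>n + 1\<close> equal steps. By \<open>sub\<close> their translates by
      \<open>u\<close> stay in \<open>B\<close>, where \<open>x n\<close> dominates the increment of
      \<open>f\<close>.\<close>
    let ?p = "\<lambda>m. a + (real m / real (Suc n)) *\<^sub>R h"
    have tint: "integrable lborel (\<lambda>u. x n (c + u))" for c
    proof (rule integrable_lborel_bounded[where B = "real (Suc n) * M" and r = "cmod c + \<rho> / 4"])
      show "\<bar>x n (c + u)\<bar> \<le> real (Suc n) * M" for u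
        using x0[of n "c + u"] xM[of n "c + u"] by linarith
      show "x n (c + u) = 0" if "u \<notin> ball 0 (cmod c + \<rho> / 4)" for u
        using that norm_triangle_ineq4[of "c + u" c] by (simp add: x_def B_def)
    qed simp
    have "?X \<le> (\<integral>u. (\<Sum>m<Suc n. x n (?p m + u) / real (Suc n)) \<partial>lborel)"
    proof (intro integral_mono fi Bochner_Integration.integrable_sum)
      show "integrable lborel (\<lambda>u. x n (?p m + u) / real (Suc n))" for m
        using tint[of "?p m"] by simp
      fix u
      show "(f (a + h + u) - f (a + u)) * indicator (ball 0 \<epsilon>) u \<le> (\<Sum>m<Suc n. x n (?p m + u) / real (Suc n))"
      proof (cases "u \<in> ball 0 \<epsilon>")
        case True
        have "f (a + h + u) - f (a + u) = f (?p (Suc n) + u) - f (?p 0 + u)" by simp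
        also have "\<dots> = (\<Sum>m<Suc n. f (?p (Suc m) + u) - f (?p m + u))"
          by (rule sum_lessThan_telescope[symmetric])
        also have "\<dots> \<le> (\<Sum>m<Suc n. x n (?p m + u) / real (Suc n))"
        proof (rule sum_mono)
          fix m assume "m \<in> {..<Suc n}"
          hence "real m / real (Suc n) \<le> 1" by (simp add: divide_le_eq)
          hence "?p m + u \<in> B" unfolding B_def using True by (intro sub) auto
          moreover have "?p (Suc m) + u = (?p m + u) + h /\<^sub>R real (Suc n)"
          proof -
            have "(real (Suc m) / real (Suc n)) *\<^sub>R h = (real m / real (Suc n)) *\<^sub>R h + h /\<^sub>R real (Suc n)"
              by (simp only: scaleR_add_left[symmetric] of_nat_Suc add_divide_distrib inverse_eq_divide add_ac)
            thus ?thesis by (simp only: add_ac)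
          qed
          ultimately show "f (?p (Suc m) + u) - f (?p m + u) \<le> x n (?p m + u) / real (Suc n)"
            using step[of "?p m + u"] by (simp only:)
        qed
        finally show ?thesis using True by simp
      next
        case False
        have "0 \<le> (\<Sum>m<Suc n. x n (?p m + u) / real (Suc n))"
          by (intro sum_nonneg divide_nonneg_nonneg x0) auto
        thus ?thesis using False by simp
      qed
    qed
    also have "\<dots> = (\<Sum>m<Suc n. (\<integral>u. x n (?p m + u) \<partial>lborel) / real (Suc n))"
      by (subst Bochner_Integration.integral_sum) (use tint in auto)
    \<comment> \<open>Translation invariance makes all \<open>n + 1\<close> terms equal, so their
      weights \<open>1/(n+1)\<close> add up to one full integral.\<close>
    also have "\<dots> = (\<Sum>m<Suc n. (\<integral>u. x n u \<partial>lborel) / real (Suc n))"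
      using integral_lborel_translation[of "x n"] by (simp add: add.commute[of "a + _"] del: sum.lessThan_Suc)
    also have "\<dots> = (\<integral>u. x n u \<partial>lborel)" by simp
    finally show ?thesis .
  qed
  have bound: "?X \<le> K * (cmod h)\<^sup>2 / L" if L: "0 < L" for L
  proof -
    have mint: "integrable lborel (\<lambda>z. min (x n z) L)" for n
      by (rule integrable_lborel_bounded[where B = L and r = "\<rho> / 4"])
         (use x0 L in \<open>auto simp: x_def B_def\<close>)
    have "(\<lambda>n. \<integral>z. min (x n z) L \<partial>lborel) \<longlonglongrightarrow> (\<integral>z. 0 \<partial>(lborel :: complex measure))"
    proof (rule integral_dominated_convergence[where w = "\<lambda>z. L * indicator B z"])
      show "integrable lborel (\<lambda>z. L * indicator B z)"
        unfolding B_def by (rule integrable_on_ball[of "\<lambda>_. L" L]) (use L in auto)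
      show "AE z in lborel. (\<lambda>n. min (x n z) L) \<longlonglongrightarrow> 0"
        using deriv
      proof (eventually_elim)
        fix z assume z: "z \<in> ball 0 (\<rho> / 4) \<longrightarrow>
          (\<lambda>n. max 0 (real (Suc n) * (f (z + h /\<^sub>R real (Suc n)) - f z))) \<longlonglongrightarrow> 0"
        have "(\<lambda>n. x n z) \<longlonglongrightarrow> 0"
        proof (cases "z \<in> B")
          case True
          thus ?thesis using z by (simp add: x_def B_def del: of_nat_Suc)
        qed (simp add: x_def)
        hence "(\<lambda>n. min (x n z) L) \<longlonglongrightarrow> min 0 L" by (intro tendsto_min tendsto_const)
        thus "(\<lambda>n. min (x n z) L) \<longlonglongrightarrow> 0" using L by simp
      qed
      show "AE z in lborel. norm (min (x n z) L) \<le> L * indicator B z" for n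
        using x0 L by (intro AE_I2) (auto simp: x_def indicator_def)
    qed auto
    hence lim: "(\<lambda>n. (\<integral>z. min (x n z) L \<partial>lborel) + K * (cmod h)\<^sup>2 / L) \<longlonglongrightarrow> 0 + K * (cmod h)\<^sup>2 / L"
      by (intro tendsto_add tendsto_const) simp
    have "?X \<le> (\<integral>z. min (x n z) L \<partial>lborel) + K * (cmod h)\<^sup>2 / L" for n
    proof -
      have "?X \<le> (\<integral>z. x n z \<partial>lborel)" by (rule X_le)
      also have "\<dots> \<le> (\<integral>z. min (x n z) L + (x n z)\<^sup>2 / L \<partial>lborel)"
      proof (intro integral_mono xint Bochner_Integration.integrable_add mint)
        show "integrable lborel (\<lambda>z. (x n z)\<^sup>2 / L)" using xsq_int[of n] by simp
        fix z
        show "x n z \<le> min (x n z) L + (x n z)\<^sup>2 / L"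
        proof (cases "x n z \<le> L")
          case True
          thus ?thesis using L by simp
        next
          case False
          have "x n z * L \<le> x n z * x n z" using False L by (intro mult_left_mono) auto
          hence "x n z \<le> (x n z)\<^sup>2 / L" using L by (simp add: le_divide_eq power2_eq_square)
          thus ?thesis using False L by simp
        qed
      qed
      also have "\<dots> = (\<integral>z. min (x n z) L \<partial>lborel) + (\<integral>z. (x n z)\<^sup>2 \<partial>lborel) / L"
        by (subst Bochner_Integration.integral_add) (use mint xsq_int in auto)
      also have "\<dots> \<le> (\<integral>z. min (x n z) L \<partial>lborel) + K * (cmod h)\<^sup>2 / L"
        using xsq[of n] L by (intro add_left_mono divide_right_mono) auto
      finally show ?thesis .
    qed
    thus ?thesis using LIMSEQ_le_const[OF lim] by auto
  qed
  show ?thesis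
  proof (rule ccontr)
    assume "\<not> ?X \<le> 0"
    hence X: "0 < ?X" by simp
    \<comment> \<open>Every \<open>L\<close> above \<open>K |h|^2 / ?X\<close> contradicts
      \<open>bound\<close>; the added 1 gives strictness and keeps \<open>L\<close>
      positive.\<close>
    define L where "L = (K * (cmod h)\<^sup>2 + 1) / ?X"
    have "0 < L" using K(1) X unfolding L_def by (intro divide_pos_pos add_nonneg_pos) auto
    from bound[OF this] have "?X * L \<le> K * (cmod h)\<^sup>2" using \<open>0 < L\<close> by (simp add: le_divide_eq)
    thus False using X by (simp add: L_def)
  qed
qed simp

text \<open>Disk means are compared first. At \<open>a + h\<close> the value is below the mean by
  \<open>submean\<close>; at \<open>a\<close> semicontinuity keeps the mean over a small disk below
  \<open>f a + e\<close>.\<close>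

lemma antitone:
  assumes \<rho>: "0 < \<rho>" "2 * \<rho> \<le> R" and a: "cmod a < \<rho> / 8" "cmod (a + h) < \<rho> / 8"
    and deriv: "AE z in lborel. z \<in> ball 0 (\<rho> / 4) \<longrightarrow>
      (\<lambda>n. max 0 (real (Suc n) * (f (z + h /\<^sub>R real (Suc n)) - f z))) \<longlonglongrightarrow> 0"
  shows "f (a + h) \<le> f a"
proof (rule field_le_epsilon)
  fix e :: real assume e: "0 < e"
  have h: "cmod h \<le> \<rho> / 4" using a norm_triangle_ineq4[of "a + h" a] by simp
  have "a \<in> ball 0 R" using a \<rho> by simp
  from usc[OF this e] obtain d where d: "0 < d" "\<And>w. dist w a < d \<Longrightarrow> f w < f a + e"
    unfolding eventually_nhds_metric by blast
  define \<epsilon> where "\<epsilon> = min d (\<rho> / 8)"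
  have \<epsilon>: "0 < \<epsilon>" "\<epsilon> \<le> d" "\<epsilon> \<le> \<rho> / 8" using d \<rho> by (auto simp: \<epsilon>_def)
  have m: "0 < measure lborel (ball (0::complex) \<epsilon>)" using \<epsilon> by simp
  have iconst: "integrable lborel (\<lambda>u. (f a + e) * indicator (ball (0::complex) \<epsilon>) u)"
    by (rule integrable_on_ball[of "\<lambda>_. f a + e" "f a + e"]) (use nonneg[of a] e in auto)
  have i: "integrable lborel (\<lambda>u. f (c + u) * indicator (ball 0 \<epsilon>) u)" for c
    by (rule integrable_on_ball[where B = M]) (use nonneg bounded in auto)
  have "(\<integral>u. (f (a + h + u) - f (a + u)) * indicator (ball 0 \<epsilon>) u \<partial>lborel) \<le> 0"
  proof (rule integral_shift_le[OF \<rho> h deriv])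
    fix t :: real and u :: complex assume t: "0 \<le> t" "t \<le> 1" and u: "u \<in> ball 0 \<epsilon>"
    have "a + t *\<^sub>R h = (1 - t) *\<^sub>R a + t *\<^sub>R (a + h)" by (simp add: algebra_simps)
    moreover have "(1 - t) *\<^sub>R a + t *\<^sub>R (a + h) \<in> ball 0 (\<rho> / 8)"
      using t a by (intro convexD[OF convex_ball]) auto
    ultimately have "cmod (a + t *\<^sub>R h) < \<rho> / 8" by simp
    thus "a + t *\<^sub>R h + u \<in> ball 0 (\<rho> / 4)"
      using u \<epsilon> norm_triangle_ineq[of "a + t *\<^sub>R h" u] by simp
  qed
  also have "(\<integral>u. (f (a + h + u) - f (a + u)) * indicator (ball 0 \<epsilon>) u \<partial>lborel)
      = (\<integral>u. f (a + h + u) * indicator (ball 0 \<epsilon>) u \<partial>lborel) - (\<integral>u. f (a + u) * indicator (ball 0 \<epsilon>) u \<partial>lborel)"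
    by (subst Bochner_Integration.integral_diff[OF i i, symmetric]) (simp add: left_diff_distrib)
  finally have 1: "(\<integral>u. f (a + h + u) * indicator (ball 0 \<epsilon>) u \<partial>lborel) \<le> (\<integral>u. f (a + u) * indicator (ball 0 \<epsilon>) u \<partial>lborel)"
    by simp
  have "cball (a + h) \<epsilon> \<subseteq> ball 0 R"
  proof
    fix w assume "w \<in> cball (a + h) \<epsilon>"
    hence "cmod w \<le> cmod (a + h) + \<epsilon>" using norm_triangle_ineq4[of "a + h" "a + h - w"] by (simp add: dist_norm)
    thus "w \<in> ball 0 R" using a \<epsilon> \<rho> by simp
  qed
  hence "f (a + h) * measure lborel (ball (0::complex) \<epsilon>) \<le> (\<integral>u. f (a + h + u) * indicator (ball 0 \<epsilon>) u \<partial>lborel)"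
    using submean[OF \<epsilon>(1)] by blast
  also note 1
  also have "(\<integral>u. f (a + u) * indicator (ball 0 \<epsilon>) u \<partial>lborel) \<le> (\<integral>u. (f a + e) * indicator (ball (0::complex) \<epsilon>) u \<partial>lborel)"
  proof (intro integral_mono i iconst)
    fix u :: complex
    show "f (a + u) * indicator (ball 0 \<epsilon>) u \<le> (f a + e) * indicator (ball 0 \<epsilon>) u"
      using d(2)[of "a + u"] \<epsilon>(2) by (auto simp: indicator_def dist_norm less_imp_le)
  qed
  also have "\<dots> = (f a + e) * measure lborel (ball (0::complex) \<epsilon>)" by simp
  finally show "f (a + h) \<le> f a + e" using m by simp
qed

text \<open>The set where \<open>f = f p\<close> is relatively closed by upper semicontinuity. It is
  open because a smaller value at one point of a disk persists on a set of positive measure and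
  would push the mean below the value \<open>f p\<close> at the centre.\<close>

lemma maximum_principle:
  assumes S: "open S" "connected S" "S \<subseteq> ball 0 R" and p: "p \<in> S" and le: "\<And>z. z \<in> S \<Longrightarrow> f z \<le> f p"
    and z: "z \<in> S"
  shows "f z = f p"
proof -
  let ?T = "{z \<in> S. f z = f p}"
  have less_open: "\<exists>d>0. \<forall>w. dist w z < d \<longrightarrow> f w < f p" if "z \<in> S" "f z < f p" for z
    using usc[of z "f p - f z"] that S(3) by (auto simp: eventually_nhds_metric)
  have "openin (top_of_set S) ?T"
  proof (subst openin_open_eq[OF S(1)], intro conjI)
    show "open ?T"
    proof (subst open_contains_ball, intro ballI)
      fix a assume a: "a \<in> ?T"
      then obtain d where d: "0 < d" "cball a d \<subseteq> S" using S(1) open_contains_cball by blast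
      have "ball a d \<subseteq> ?T"
      proof (rule ccontr)
        assume "\<not> ball a d \<subseteq> ?T"
        then obtain b where b: "b \<in> ball a d" "b \<in> S" "f b \<noteq> f p" using d ball_subset_cball[of a d] by blast
        hence "f b < f p" using le[of b] by simp
        from less_open[OF b(2) this] obtain e where e: "0 < e" "\<And>w. dist w b < e \<Longrightarrow> f w < f p" by blast
        let ?F = "\<lambda>u. (f p - f (a + u)) * indicator (ball 0 d) u"
        have F0: "0 \<le> ?F u" for u
        proof (cases "u \<in> ball 0 d")
          case True
          hence "a + u \<in> S" using d(2) by (auto simp: dist_norm subset_iff)
          thus ?thesis using le[of "a + u"] True by simp
        qed simp
        have i1: "integrable lborel (\<lambda>u. f (a + u) * indicator (ball 0 d) u)"
          by (rule integrable_on_ball[where B = M]) (use nonneg bounded in auto)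
        have i2: "integrable lborel (\<lambda>u. f p * indicator (ball (0::complex) d) u)"
          by (rule integrable_on_ball[of "\<lambda>_. f p" "f p"]) (use nonneg in auto)
        have Fi: "integrable lborel ?F"
          using Bochner_Integration.integrable_diff[OF i2 i1] by (simp add: left_diff_distrib)
        have "(\<integral>u. ?F u \<partial>lborel) = f p * measure lborel (ball (0::complex) d) - (\<integral>u. f (a + u) * indicator (ball 0 d) u \<partial>lborel)"
          using Bochner_Integration.integral_diff[OF i2 i1] by (simp add: left_diff_distrib)
        also have "\<dots> \<le> 0"
          using submean[OF d(1), of a] d(2) S(3) a by auto
        finally have "(\<integral>u. ?F u \<partial>lborel) = 0"
          using F0 by (intro antisym Bochner_Integration.integral_nonneg) auto
        hence AE0: "AE u in lborel. ?F u = 0"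
          using integral_nonneg_eq_0_iff_AE[OF Fi] F0 by auto
        have "open (ball 0 d \<inter> ball (b - a) e)" by auto
        moreover have "b - a \<in> ball 0 d \<inter> ball (b - a) e"
          using b e by (auto simp: dist_norm norm_minus_commute)
        ultimately obtain u where u: "u \<in> ball 0 d \<inter> ball (b - a) e" "?F u = 0"
          by (metis AE_lborel_open_ex[OF AE0] empty_iff)
        have "dist (a + u) b < e" using u(1) by (simp add: dist_norm norm_minus_commute algebra_simps)
        thus False using e(2)[of "a + u"] u by simp
      qed
      thus "\<exists>e>0. ball a e \<subseteq> ?T" using d(1) by blast
    qed
  qed auto
  moreover have "closedin (top_of_set S) ?T"
  proof -
    have "open {z \<in> S. f z < f p}"
    proof (subst open_contains_ball, intro ballI)
      fix a assume a: "a \<in> {z \<in> S. f z < f p}"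
      then obtain d where d: "0 < d" "ball a d \<subseteq> S" using S(1) open_contains_ball by blast
      obtain e where e: "0 < e" "\<And>w. dist w a < e \<Longrightarrow> f w < f p" using less_open a by blast
      have "ball a (min d e) \<subseteq> {z \<in> S. f z < f p}" using d e by (auto simp: dist_commute)
      thus "\<exists>e>0. ball a e \<subseteq> {z \<in> S. f z < f p}" using d(1) e(1) by (intro exI[of _ "min d e"]) auto
    qed
    moreover have "?T = S \<inter> - {z \<in> S. f z < f p}" using le by force
    ultimately show ?thesis
      unfolding closedin_closed by (intro exI[of _ "- {z \<in> S. f z < f p}"]) auto
  qed
  ultimately have "?T = S"
    using S(2) p unfolding connected_clopen by blast
  thus ?thesis using z by auto
qed

end


section \<open>Subharmonic functions\<close>

lemma frechet_derivative_partials: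
  assumes "f differentiable (at z)"
  shows "frechet_derivative f (at z) h = Re h * partial_x f z + Im h * partial_y f z"
proof -
  interpret D: bounded_linear "frechet_derivative f (at z)"
    using assms frechet_derivative_works has_derivative_bounded_linear by blast
  have "h = Re h *\<^sub>R 1 + Im h *\<^sub>R \<i>" by (simp add: complex_eq_iff)
  hence "frechet_derivative f (at z) h = frechet_derivative f (at z) (Re h *\<^sub>R 1 + Im h *\<^sub>R \<i>)"
    by (rule arg_cong)
  thus ?thesis by (simp add: D.add D.scaleR partial_x_def partial_y_def)
qed

text \<open>For real \<open>f\<close> the differential applied to \<open>h\<close> is
  \<open>d * h\<close> plus its complex conjugate, hence the factor 2.\<close>

lemma has_dz_imp_has_derivative:
  assumes "has_dz f d z"
  shows "(f has_derivative (\<lambda>h. 2 * Re (d * h))) (at z)"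
proof -
  have f: "f differentiable (at z)"
    and d: "d = (complex_of_real (partial_x f z) - \<i> * complex_of_real (partial_y f z)) / 2"
    using assms by (auto simp: has_dz_def)
  have "frechet_derivative f (at z) = (\<lambda>h. 2 * Re (d * h))"
    by (rule ext) (simp add: frechet_derivative_partials[OF f] d algebra_simps)
  thus ?thesis using f frechet_derivative_works by metis
qed

lemma has_dz_diff_constant:
  assumes "open S" "connected S" "\<And>z. z \<in> S \<Longrightarrow> has_dz f (g z) z" "\<And>z. z \<in> S \<Longrightarrow> has_dz h (g z) z"
  obtains c where "\<And>z. z \<in> S \<Longrightarrow> f z - h z = c"
proof -
  have der: "((\<lambda>z. f z - h z) has_derivative (\<lambda>_. 0)) (at z)" if "z \<in> S" for z
    using has_derivative_diff[OF has_dz_imp_has_derivative[OF assms(3)[OF that]]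
        has_dz_imp_has_derivative[OF assms(4)[OF that]]] by simp
  show thesis
    \<comment> \<open>The base point is \<open>SOME z. z \<in> S\<close>; its membership is required
      only when a point of \<open>S\<close> is given, so \<open>S\<close> may be empty.\<close>
    by (rule that, rule has_derivative_zero_unique_connected[OF assms(1,2) der _ someI_ex[of "\<lambda>z. z \<in> S"]]) auto
qed

text \<open>Cauchy's formula at the centre: the derivative of the parametrisation cancels the
  denominator up to the factor i.\<close>

lemma holomorphic_circle_mean:
  fixes G :: "complex \<Rightarrow> complex"
  assumes "G holomorphic_on cball a s" "0 < s"
  shows "((\<lambda>t. G (a + of_real s * cis t)) has_integral (of_real (2 * pi) * G a)) {0..2*pi}"
proof -
  have "((\<lambda>u. G u / (u - a)) has_contour_integral (2 * of_real pi * \<i> * G a)) (part_circlepath a s 0 (2 * pi))"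
    using Cauchy_integral_circlepath_simple[OF assms(1), of a] assms(2) by (simp add: circlepath_def)
  hence "((\<lambda>t. G (a + of_real s * cis t) / (a + of_real s * cis t - a) * of_real s * \<i> * cis t)
      has_integral (2 * of_real pi * \<i> * G a)) {0..2*pi}"
    by (subst (asm) has_contour_integral_part_circlepath_iff) auto
  also have "(\<lambda>t. G (a + of_real s * cis t) / (a + of_real s * cis t - a) * of_real s * \<i> * cis t)
      = (\<lambda>t. \<i> * G (a + of_real s * cis t))"
    using assms(2) by (auto simp: cis_neq_zero)
  finally have hi: "((\<lambda>t. -\<i> * (\<i> * G (a + of_real s * cis t)))
      has_integral (-\<i> * (2 * of_real pi * \<i> * G a))) {0..2*pi}"
    by (rule has_integral_mult_right)
  have rot: "-\<i> * (\<i> * w) = w" "-\<i> * (2 * of_real pi * \<i> * w) = of_real (2 * pi) * w" for w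
    by (auto simp: complex_eq_iff)
  show ?thesis using hi by (simp only: rot)
qed

text \<open>On the convex set \<open>D\<close> the function \<open>2 g\<close> has a primitive
  \<open>G\<close>, and \<open>H - Re G\<close> has derivative 0. So \<open>H\<close> inherits the
  mean value property from \<open>G\<close>.\<close>

lemma has_dz_circle_mean:
  assumes "g holomorphic_on D" "\<And>z. z \<in> D \<Longrightarrow> has_dz H (g z) z" "open D" "convex D"
    and "cball a s \<subseteq> D" "0 < s"
  shows "((\<lambda>t. H (a + of_real s * cis t)) has_integral (2 * pi * H a)) {0..2*pi}"
proof -
  have hol: "(\<lambda>z. 2 * g z) holomorphic_on D" using assms(1) by (intro holomorphic_intros)
  have "\<exists>G. \<forall>z\<in>D. (G has_field_derivative (2 * g z)) (at z within D)"
    by (rule holomorphic_convex_primitive'[OF assms(4,3) hol]) (rule exI, rule ballI)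
  then obtain G where G: "\<forall>z\<in>D. (G has_field_derivative (2 * g z)) (at z within D)" ..
  have G': "(G has_field_derivative (2 * g z)) (at z)" if "z \<in> D" for z
    using bspec[OF G that] unfolding at_within_open[OF that assms(3)] .
  have G'': "((\<lambda>z. Re (G z)) has_derivative (\<lambda>h. 2 * Re (g z * h))) (at z)" if "z \<in> D" for z
    using has_derivative_Re[OF G'[OF that, unfolded has_field_derivative_def]] by (simp add: mult.assoc)
  have der: "((\<lambda>z. H z - Re (G z)) has_derivative (\<lambda>_. 0)) (at z)" if "z \<in> D" for z
    using has_derivative_diff[OF has_dz_imp_has_derivative[OF assms(2)[OF that]] G''[OF that]] by simp
  have aD: "a \<in> D" using assms(5,6) by auto
  define c where "c = H a - Re (G a)"
  have c: "H z - Re (G z) = c" if "z \<in> D" for z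
    unfolding c_def
    by (rule has_derivative_zero_unique_connected[OF assms(3) convex_connected[OF assms(4)] der that aD])
  have "G holomorphic_on D" using G unfolding holomorphic_on_def field_differentiable_def by blast
  hence "G holomorphic_on cball a s" using assms(5) by (rule holomorphic_on_subset)
  from has_integral_Re[OF holomorphic_circle_mean[OF this assms(6)]]
  have "((\<lambda>t. Re (G (a + of_real s * cis t)) + c) has_integral (2 * pi * Re (G a) + 2 * pi * c)) {0..2*pi}"
    using has_integral_const_real[of c 0 "2 * pi"] by (intro has_integral_add) (auto simp: mult_ac)
  moreover have "a + of_real s * cis t \<in> D" for t
    using assms(5,6) by (auto simp: subset_iff dist_norm norm_mult)
  from c[OF this] c[OF aD] have "H a = Re (G a) + c" "H (a + of_real s * cis t) = Re (G (a + of_real s * cis t)) + c" for t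
    by (simp_all add: algebra_simps)
  ultimately show ?thesis
    by (simp add: distrib_left)
qed

section \<open>Circle means and poles of subharmonic functions\<close>

lemma usc_on_open_less:
  assumes "usc_on D V" "open D"
  shows "open {z \<in> D. V z < a}"
  using assms by (auto simp: usc_on_def openin_open_eq)

lemma usc_on_measurable:
  assumes "usc_on D V" "open D"
  shows "(\<lambda>z. if z \<in> D then V z else 0) \<in> borel_measurable borel"
proof (rule borel_measurableI_less)
  fix a :: ereal
  have "{z \<in> space borel. (if z \<in> D then V z else 0) < a}
      = {z \<in> D. V z < a} \<union> (if 0 < a then - D else {})" by auto
  thus "{z \<in> space borel. (if z \<in> D then V z else 0) < a} \<in> sets borel"
    using usc_on_open_less[OF assms, of a] assms(2) by auto
qed

lemma usc_on_bounded_above: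
  assumes "usc_on D V" "open D" "\<forall>z\<in>D. V z \<noteq> \<infinity>" "compact S" "S \<subseteq> D"
  obtains B :: real where "\<And>z. z \<in> S \<Longrightarrow> V z < ereal B"
proof -
  let ?F = "\<lambda>n::nat. {z \<in> D. V z < ereal (real n)}"
  have "S \<subseteq> \<Union>(range ?F)"
  proof
    fix z assume z: "z \<in> S"
    hence "V z \<noteq> \<infinity>" using assms by auto
    then obtain n where "V z < ereal (real n)"
      using reals_Archimedean2[of "real_of_ereal (V z)"] by (cases "V z") auto
    thus "z \<in> \<Union>(range ?F)" using z assms(5) by auto
  qed
  then obtain C where C: "finite C" "S \<subseteq> \<Union>(?F ` C)"
    using compactE_image[OF assms(4), of UNIV ?F] usc_on_open_less[OF assms(1,2)] by auto
  show thesis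
  proof
    fix z assume "z \<in> S"
    then obtain n where n: "n \<in> C" "V z < ereal (real n)" using C by auto
    \<comment> \<open>The sum bounds each of the finitely many indices and, unlike a maximum, makes
      sense for empty \<open>C\<close>.\<close>
    have "real n \<le> real (\<Sum>C)" using C(1) n(1) by (simp only: of_nat_le_iff) (rule member_le_sum, auto)
    thus "V z < ereal (real (\<Sum>C))" using n(2) by (meson ereal_less_eq(3) less_le_trans)
  qed
qed

lemma ennreal_integral_le_nn_integral:
  assumes "integrable M (f :: _ \<Rightarrow> real)"
  shows "ennreal (integral\<^sup>L M f) \<le> (\<integral>\<^sup>+x. ennreal (f x) \<partial>M)"
proof -
  have "integral\<^sup>L M f \<le> enn2real (\<integral>\<^sup>+x. ennreal (f x) \<partial>M)"
    by (subst real_lebesgue_integral_def[OF assms]) simp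
  hence "ennreal (integral\<^sup>L M f) \<le> ennreal (enn2real (\<integral>\<^sup>+x. ennreal (f x) \<partial>M))"
    by (rule ennreal_leI)
  also have "\<dots> = (\<integral>\<^sup>+x. ennreal (f x) \<partial>M)"
    using assms unfolding real_integrable_def by (intro ennreal_enn2real) (simp add: less_top)
  finally show ?thesis .
qed

text \<open>An upper bound for \<open>V\<close> on the circle makes \<open>P\<close> finite. If
  \<open>N\<close> were infinite, the mean would be \<open>-\<infinity>\<close> and lie below
  \<open>V a\<close>. With both finite, the extended-real mean is an ordinary integral.\<close>

lemma circle_mean_finite:
  assumes sub: "subharmonic_on D V" and D: "open D" and s: "0 < s" "cball a s \<subseteq> D"
    and a: "V a \<noteq> -\<infinity>"
  defines "v \<equiv> \<lambda>t. real_of_ereal (V (a + of_real s * cis t)) * indicator {0..2*pi} t"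
  shows "AE t in lborel. t \<in> {0..2*pi} \<longrightarrow> V (a + of_real s * cis t) \<noteq> -\<infinity>"
    and "integrable lborel v"
    and "2 * pi * real_of_ereal (V a) \<le> (\<integral>t. v t \<partial>lborel)"
proof -
  have usc: "usc_on D V" and fin: "\<forall>z\<in>D. V z \<noteq> \<infinity>" and mean: "V a \<le> circle_mean V a s"
    using sub s unfolding subharmonic_on_def by auto
  let ?c = "\<lambda>t. a + of_real s * cis t"
  have cD: "?c t \<in> cball a s" for t using s by (simp add: dist_norm norm_mult)
  hence cD': "?c t \<in> D" for t using s by blast
  obtain B where B: "\<And>z. z \<in> cball a s \<Longrightarrow> V z < ereal B"
    using usc_on_bounded_above[OF usc D fin compact_cball s(2)] by blast
  have cm: "?c \<in> borel_measurable borel" unfolding cis_conv_exp by measurable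
  have "(\<lambda>t. if ?c t \<in> D then V (?c t) else 0) \<in> borel_measurable borel"
    using measurable_compose[OF cm usc_on_measurable[OF usc D]] by simp
  hence [measurable]: "(\<lambda>t. V (?c t)) \<in> borel_measurable borel" using cD' by simp
  define P where "P = (\<integral>\<^sup>+t\<in>{0..2 * pi}. e2ennreal (V (?c t)) \<partial>lborel)"
  define N where "N = (\<integral>\<^sup>+t\<in>{0..2 * pi}. e2ennreal (- V (?c t)) \<partial>lborel)"
  have P: "P < \<infinity>"
  proof -
    have "P \<le> (\<integral>\<^sup>+t. ennreal B * indicator {0..2*pi} t \<partial>lborel)"
      unfolding P_def
    proof (intro nn_integral_mono mult_right_mono)
      fix t
      have "e2ennreal (V (?c t)) \<le> e2ennreal (ereal B)"
        using B[OF cD[of t]] by (intro e2ennreal_mono) auto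
      thus "e2ennreal (V (?c t)) \<le> ennreal B" by simp
    qed auto
    also have "\<dots> < \<infinity>" by (simp add: nn_integral_cmult_indicator ennreal_mult_less_top)
    finally show ?thesis .
  qed
  have mean': "V a \<le> (enn2ereal P - enn2ereal N) / ereal (2 * pi)"
    using mean by (simp add: circle_mean_def P_def N_def)
  obtain p where p: "P = ennreal p" "0 \<le> p" using P by (cases P) auto
  have N: "N < \<infinity>"
  proof (rule ccontr)
    assume "\<not> N < \<infinity>"
    hence "N = top" by (metis infinity_ennreal_def top.not_eq_extremum)
    hence "(enn2ereal P - enn2ereal N) / ereal (2 * pi) = -\<infinity>"
      using p by simp
    thus False using mean' a by simp
  qed
  obtain n where n: "N = ennreal n" "0 \<le> n" using N by (cases N) auto
  show AE: "AE t in lborel. t \<in> {0..2*pi} \<longrightarrow> V (?c t) \<noteq> -\<infinity>"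
  proof -
    have "AE t in lborel. e2ennreal (- V (?c t)) * indicator {0..2*pi} t \<noteq> \<infinity>"
      by (rule nn_integral_noteq_infinite) (use N in \<open>auto simp: N_def\<close>)
    thus ?thesis
      by eventually_elim (auto simp: indicator_def e2ennreal_infty)
  qed
  have real: "V (?c t) = ereal (real_of_ereal (V (?c t)))" if "V (?c t) \<noteq> -\<infinity>" for t
    using that B[OF cD[of t]] by (cases "V (?c t)") auto
  have Pv: "(\<integral>\<^sup>+t. ennreal (v t) \<partial>lborel) = P"
    unfolding P_def
  proof (rule nn_integral_cong_AE, use AE in eventually_elim)
    fix t assume t: "t \<in> {0..2*pi} \<longrightarrow> V (?c t) \<noteq> -\<infinity>"
    show "ennreal (v t) = e2ennreal (V (?c t)) * indicator {0..2*pi} t"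
    proof (cases "t \<in> {0..2*pi}")
      case True
      hence "e2ennreal (V (?c t)) = e2ennreal (ereal (real_of_ereal (V (?c t))))"
        using t real[of t] by simp
      thus ?thesis using True by (simp add: v_def)
    qed (simp add: v_def)
  qed
  have Nv: "(\<integral>\<^sup>+t. ennreal (- v t) \<partial>lborel) = N"
    unfolding N_def
  proof (rule nn_integral_cong_AE, use AE in eventually_elim)
    fix t assume t: "t \<in> {0..2*pi} \<longrightarrow> V (?c t) \<noteq> -\<infinity>"
    show "ennreal (- v t) = e2ennreal (- V (?c t)) * indicator {0..2*pi} t"
    proof (cases "t \<in> {0..2*pi}")
      case True
      hence "e2ennreal (- V (?c t)) = e2ennreal (- ereal (real_of_ereal (V (?c t))))"
        using t real[of t] by simp
      thus ?thesis using True by (simp add: v_def)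
    qed (simp add: v_def)
  qed
  show vi: "integrable lborel v"
    unfolding real_integrable_def Pv Nv using P N by (auto simp: v_def)
  have "(\<integral>t. v t \<partial>lborel) = p - n"
    using p n by (subst real_lebesgue_integral_def[OF vi]) (simp add: Pv Nv)
  moreover have "V a \<le> ereal ((p - n) / (2 * pi))"
    using mean' p n by simp
  hence "real_of_ereal (V a) \<le> (p - n) / (2 * pi)"
    using a by (cases "V a") auto
  ultimately show "2 * pi * real_of_ereal (V a) \<le> (\<integral>t. v t \<partial>lborel)"
    by (simp add: le_divide_eq mult_ac)
qed

text \<open>The circle about \<open>a\<close> through \<open>p\<close> has an arc of positive length
  inside \<open>U\<close>, whereas a finite value at the centre allows poles only on a null set of
  angles.\<close>

lemma not_eq_minfinity_on_arc:
  assumes sub: "subharmonic_on D V" and D: "open D" and s: "cball a (dist a p) \<subseteq> D" "p \<noteq> a"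
    and p: "open U" "p \<in> U" "\<And>z. z \<in> U \<Longrightarrow> V z = -\<infinity>"
  shows "V a = -\<infinity>"
proof (rule ccontr)
  assume a: "V a \<noteq> -\<infinity>"
  define s where "s = dist a p"
  have s0: "0 < s" using s by (simp add: s_def)
  let ?c = "\<lambda>t. a + of_real s * cis t"
  have AE: "AE t in lborel. t \<in> {0..2*pi} \<longrightarrow> V (?c t) \<noteq> -\<infinity>"
    using circle_mean_finite(1)[OF sub D s0 _ a] s by (simp add: s_def)
  have cont: "continuous_on UNIV ?c" unfolding cis_conv_exp by (intro continuous_intros)
  define \<theta> where "\<theta> = Arg2pi (p - a)"
  have "p - a = of_real (cmod (p - a)) * cis \<theta>"
    unfolding \<theta>_def cis_conv_exp by (rule Arg2pi_eq)
  hence c\<theta>: "?c \<theta> = p" by (simp add: s_def dist_norm norm_minus_commute algebra_simps)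
  have \<theta>: "0 \<le> \<theta>" "\<theta> < 2 * pi" by (auto simp: \<theta>_def Arg2pi_ge_0 Arg2pi_lt_2pi)
  have "open (?c -` U)" using cont p(1) by (simp add: open_vimage)
  moreover have "\<theta> \<in> ?c -` U" using c\<theta> p(2) by simp
  ultimately obtain d where d: "0 < d" "ball \<theta> d \<subseteq> ?c -` U" using open_contains_ball by blast
  \<comment> \<open>The interval lies to the right of \<open>\<theta>\<close> and is cut at
    \<open>2 * pi\<close> to stay in the range of angles.\<close>
  have "open ({\<theta><..<min (2*pi) (\<theta> + d)})" "{\<theta><..<min (2*pi) (\<theta> + d)} \<noteq> {}" using d \<theta> by auto
  from AE_lborel_open_ex[OF AE this] obtain t where
    t: "t \<in> {\<theta><..<min (2*pi) (\<theta> + d)}" "t \<in> {0..2*pi} \<longrightarrow> V (?c t) \<noteq> -\<infinity>" by blast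
  hence "t \<in> ball \<theta> d" by (auto simp: dist_real_def)
  hence "V (?c t) = -\<infinity>" using d p(3) by auto
  thus False using t \<theta> by auto
qed

text \<open>The interior of the pole set is relatively closed: every centre close to one of its
  limit points has a circle through an interior pole. By connectedness it would be all of
  \<open>D\<close>, which the definition of subharmonicity excludes.\<close>

lemma interior_minfinity_empty:
  assumes sub: "subharmonic_on D V" and D: "open D" "connected D"
    and U: "open U" "U \<subseteq> D" "\<And>z. z \<in> U \<Longrightarrow> V z = -\<infinity>"
  shows "U = {}"
proof (rule ccontr)
  assume ne: "U \<noteq> {}"
  define I where "I = interior {z \<in> D. V z = -\<infinity>}"
  have I: "open I" "I \<subseteq> D" "\<And>z. z \<in> I \<Longrightarrow> V z = -\<infinity>"
    using interior_subset[of "{z \<in> D. V z = -\<infinity>}"] by (auto simp: I_def)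
  have "U \<subseteq> I" unfolding I_def using U by (intro interior_maximal) auto
  hence Ine: "I \<noteq> {}" using ne by auto
  have cl: "b \<in> I" if b: "b \<in> D" "b \<in> closure I" for b
  proof -
    obtain d where d: "0 < d" "ball b d \<subseteq> D" using D(1) b(1) open_contains_ball by blast
    \<comment> \<open>Centres within \<open>d/4\<close> of \<open>b\<close> and radii below
      \<open>d/2\<close> keep all the disks inside \<open>ball b d\<close>.\<close>
    have "0 < d / 4" using d(1) by simp
    then obtain p where p: "p \<in> I" "dist p b < d / 4"
      using b(2) unfolding closure_approachable by blast
    have "V a = -\<infinity>" if a: "a \<in> ball b (d / 4)" for a
    proof (cases "a = p")
      case False
      have "dist a p < d / 2" using a p(2) dist_triangle[of a p b] by (simp add: dist_commute)
      have "cball a (dist a p) \<subseteq> ball b d"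
      proof
        fix w assume "w \<in> cball a (dist a p)"
        thus "w \<in> ball b d"
          using \<open>dist a p < d / 2\<close> a dist_triangle[of b w a] d(1) by simp
      qed
      hence "cball a (dist a p) \<subseteq> D" using d(2) by blast
      thus ?thesis using not_eq_minfinity_on_arc[OF sub D(1) _ _ I(1) p(1) I(3), of a] False by auto
    qed (use p I in auto)
    moreover have "ball b (d / 4) \<subseteq> D" using d by auto
    ultimately have "ball b (d / 4) \<subseteq> I" unfolding I_def by (intro interior_maximal) auto
    thus ?thesis using d(1) by auto
  qed
  have "openin (top_of_set D) I" using I D by (simp add: openin_open_eq)
  moreover have "closedin (top_of_set D) I"
    unfolding closedin_closed by (intro exI[of _ "closure I"]) (use cl I(2) closure_subset in auto)
  ultimately have "I = D" using D(2) Ine unfolding connected_clopen by blast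
  moreover have "D \<in> components D"
    using D(2) Ine I(2) by (subst in_components_maximal) auto
  ultimately show False using sub I(3) unfolding subharmonic_on_def by blast
qed


section \<open>The exponential of a subharmonic minus a harmonic function\<close>

lemma has_dz_continuous_on:
  assumes "\<And>z. z \<in> S \<Longrightarrow> has_dz f (g z) z"
  shows "continuous_on S f"
  using has_derivative_continuous[OF has_dz_imp_has_derivative[OF assms]]
  by (intro continuous_at_imp_continuous_on ballI)

text \<open>The value 0 at a pole is the limit of exp at \<open>-\<infinity>\<close>; without the
  case distinction \<open>real_of_ereal\<close> would read a pole as \<open>V z = 0\<close>. The
  cutoff at radius \<open>r\<close> gives the form that \<open>bounded_submean\<close> asks
  for.\<close>

definition exp_diff :: "real \<Rightarrow> (complex \<Rightarrow> ereal) \<Rightarrow> (complex \<Rightarrow> real) \<Rightarrow> complex \<Rightarrow> real" where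
  "exp_diff r V H z = (if z \<in> ball 0 r \<and> V z \<noteq> -\<infinity> then exp (real_of_ereal (V z) - H z) else 0)"

text \<open>Jensen's inequality through the tangent of exp at \<open>m = V a - H a\<close>.
  \<open>L\<close> is that tangent applied to \<open>V - H\<close> on the circle; its integral is at
  least \<open>2 pi exp m\<close>, because \<open>V\<close> is below its mean at \<open>a\<close>
  and \<open>H\<close> equals its mean.\<close>

lemma exp_diff_circle:
  assumes sub: "subharmonic_on D V" and D: "open D" and s: "0 < s" "cball a s \<subseteq> D"
    and H: "continuous_on D H" "((\<lambda>t. H (a + of_real s * cis t)) has_integral (2 * pi * H a)) {0..2*pi}"
    and r: "cball a s \<subseteq> ball 0 r"
  shows "ennreal (2 * pi) * ennreal (exp_diff r V H a)
    \<le> (\<integral>\<^sup>+t\<in>{0..2*pi}. ennreal (exp_diff r V H (a + of_real s * cis t)) \<partial>lborel)"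
proof (cases "V a = -\<infinity>")
  case False
  let ?c = "\<lambda>t. a + of_real s * cis t"
  have cD: "?c t \<in> cball a s" for t using s by (simp add: dist_norm norm_mult)
  have aD: "a \<in> cball a s" using s by simp
  define v where "v t = real_of_ereal (V (?c t)) * indicator {0..2*pi} t" for t
  define h where "h t = H (?c t) * indicator {0..2*pi} t" for t
  define m where "m = real_of_ereal (V a) - H a"
  note fin = circle_mean_finite[OF sub D s False, folded v_def]
  have cont: "continuous_on {0..2*pi} (\<lambda>t. H (?c t))"
    by (rule continuous_on_compose2[OF H(1)])
       (use cD s in \<open>auto simp: cis_conv_exp intro!: continuous_intros\<close>)
  have hi: "integrable lborel h" and hI: "(\<integral>t. h t \<partial>lborel) = 2 * pi * H a"
  proof -
    have si: "set_integrable lborel {0..2*pi} (\<lambda>t. H (?c t))"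
      using borel_integrable_atLeastAtMost'[OF cont] .
    thus "integrable lborel h" unfolding h_def set_integrable_def by (simp add: mult.commute)
    have "(\<integral>t. h t \<partial>lborel) = (LINT t:{0..2*pi}|lborel. H (?c t))"
      unfolding h_def set_lebesgue_integral_def by (simp add: mult.commute)
    also have "\<dots> = integral {0..2*pi} (\<lambda>t. H (?c t))"
      by (rule set_borel_integral_eq_integral(2)[OF si])
    also have "\<dots> = 2 * pi * H a" using H(2) by (rule integral_unique)
    finally show "(\<integral>t. h t \<partial>lborel) = 2 * pi * H a" .
  qed
  have oi: "integrable lborel (\<lambda>t. indicator {0..2*pi} t :: real)" by auto
  define L where "L t = exp m * (v t - h t + (1 - m) * indicator {0..2*pi} t)" for t
  have Li: "integrable lborel L" unfolding L_def using fin(2) hi oi by auto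
  have "(\<integral>t. L t \<partial>lborel) = exp m * ((\<integral>t. v t \<partial>lborel) - 2 * pi * H a + (1 - m) * (2 * pi))"
    unfolding L_def using fin(2) hi oi by (simp add: hI)
  also have "\<dots> \<ge> exp m * (2 * pi * real_of_ereal (V a) - 2 * pi * H a + (1 - m) * (2 * pi))"
    using fin(3) by (intro mult_left_mono add_right_mono diff_right_mono) auto
  also have "exp m * (2 * pi * real_of_ereal (V a) - 2 * pi * H a + (1 - m) * (2 * pi)) = 2 * pi * exp m"
    by (simp add: m_def algebra_simps)
  finally have L: "2 * pi * exp m \<le> (\<integral>t. L t \<partial>lborel)" .
  have "a \<in> ball 0 r" using aD r by blast
  hence "exp_diff r V H a = exp m" using False by (simp add: exp_diff_def m_def)
  hence "ennreal (2 * pi) * ennreal (exp_diff r V H a) = ennreal (2 * pi * exp m)"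
    by (simp add: ennreal_mult)
  also have "\<dots> \<le> ennreal (\<integral>t. L t \<partial>lborel)" using L by (rule ennreal_leI)
  also have "\<dots> \<le> (\<integral>\<^sup>+t. ennreal (L t) \<partial>lborel)" by (rule ennreal_integral_le_nn_integral[OF Li])
  also have "\<dots> \<le> (\<integral>\<^sup>+t\<in>{0..2*pi}. ennreal (exp_diff r V H (?c t)) \<partial>lborel)"
  proof (rule nn_integral_mono_AE, use fin(1) in eventually_elim)
    fix t assume t: "t \<in> {0..2*pi} \<longrightarrow> V (?c t) \<noteq> -\<infinity>"
    show "ennreal (L t) \<le> ennreal (exp_diff r V H (?c t)) * indicator {0..2*pi} t"
    proof (cases "t \<in> {0..2*pi}")
      case True
      define x where "x = real_of_ereal (V (?c t)) - H (?c t)"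
      have "exp m * (1 + (x - m)) \<le> exp m * exp (x - m)"
        by (intro mult_left_mono exp_ge_add_one_self) auto
      also have "\<dots> = exp x" by (simp flip: exp_add)
      finally have "L t \<le> exp x" using True by (simp add: L_def v_def h_def x_def algebra_simps)
      moreover have "exp_diff r V H (?c t) = exp x"
        using t True cD[of t] r unfolding exp_diff_def x_def by auto
      ultimately show ?thesis using True by (simp add: ennreal_leI)
    qed (simp add: L_def v_def h_def)
  qed
  finally show ?thesis .
qed (simp add: exp_diff_def)

lemma exp_diff_measurable:
  assumes "usc_on D V" "open D" "continuous_on D H" "ball 0 r \<subseteq> D"
  shows "exp_diff r V H \<in> borel_measurable borel"
proof -
  define V' where "V' z = (if z \<in> D then V z else 0)" for z
  define H' where "H' z = indicator D z *\<^sub>R H z" for z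
  have [measurable]: "V' \<in> borel_measurable borel" "H' \<in> borel_measurable borel"
    unfolding V'_def H'_def using usc_on_measurable[OF assms(1,2)]
      borel_measurable_continuous_on_indicator[OF borel_open[OF assms(2)] assms(3)] by simp_all
  have "exp_diff r V H = (\<lambda>z. if z \<in> ball 0 r \<and> V' z \<noteq> -\<infinity> then exp (real_of_ereal (V' z) - H' z) else 0)"
    using assms(4) by (auto simp: fun_eq_iff exp_diff_def V'_def H'_def)
  also have "\<dots> \<in> borel_measurable borel" by measurable
  finally show ?thesis .
qed

lemma exp_diff_usc:
  assumes "usc_on D V" "open D" "\<forall>z\<in>D. V z \<noteq> \<infinity>" "continuous_on D H" "ball 0 r \<subseteq> D"
    and z: "z \<in> ball 0 r" and e: "0 < e"
  shows "\<forall>\<^sub>F w in nhds z. exp_diff r V H w < exp_diff r V H z + e"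
proof -
  define L where "L = ln (exp_diff r V H z + e)"
  have pos: "0 < exp_diff r V H z + e" using e by (auto simp: exp_diff_def intro: add_pos_pos)
  hence L: "exp L = exp_diff r V H z + e" by (simp add: L_def)
  have zD: "z \<in> D" using assms by auto
  have "V z < ereal (L + H z)"
  proof (cases "V z")
    case (real x)
    hence "exp (x - H z) < exp L" using L z e by (simp add: exp_diff_def)
    thus ?thesis using real by simp
  qed (use assms(3) zD in auto)
  \<comment> \<open>The gap between \<open>V z\<close> and \<open>L + H z\<close> is split at
    \<open>b\<close>: semicontinuity keeps \<open>V\<close> below \<open>b\<close>, continuity keeps
    \<open>L + H\<close> above it.\<close>
  then obtain b where b: "V z < ereal b" "b < L + H z"
    using ereal_dense2[of "V z" "ereal (L + H z)"] by auto
  have "\<forall>\<^sub>F w in nhds z. w \<in> {w \<in> D. V w < ereal b}"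
    using usc_on_open_less[OF assms(1,2)] b zD by (intro eventually_nhds_in_open) auto
  moreover have "\<forall>\<^sub>F w in nhds z. b - L < H w"
  proof (rule order_tendstoD(1))
    have "isCont H z" using assms(2,4) zD by (simp add: continuous_on_eq_continuous_at)
    thus "(H \<longlongrightarrow> H z) (nhds z)" by (simp add: isCont_def tendsto_nhds_iff)
  qed (use b in simp)
  ultimately show ?thesis
  proof eventually_elim
    case (elim w)
    show ?case
    proof (cases "w \<in> ball 0 r \<and> V w \<noteq> -\<infinity>")
      case True
      then obtain x where x: "V w = ereal x" using elim by (cases "V w") auto
      hence "x - H w < L" using elim by simp
      hence "exp (x - H w) < exp L" by simp
      moreover have "exp_diff r V H w = exp (x - H w)" using True x by (simp add: exp_diff_def)
      ultimately show ?thesis by (simp only: L)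
    next
      case False
      hence "exp_diff r V H w = 0" unfolding exp_diff_def by (simp only: if_False)
      thus ?thesis using pos by (simp only:)
    qed
  qed
qed

text \<open>The strict inequality \<open>r < R\<close> makes the closed disk of radius
  \<open>r\<close> a compact subset of the domain, on which \<open>V\<close> is bounded above and
  \<open>H\<close> is bounded.\<close>

lemma bounded_submean_exp_diff:
  assumes sub: "subharmonic_on (ball 0 R) V" and r: "0 < r" "r < R"
    and g: "g holomorphic_on ball 0 R" and H: "\<And>z. z \<in> ball 0 R \<Longrightarrow> has_dz H (g z) z"
  obtains M where "bounded_submean (exp_diff r V H) r M"
proof -
  let ?D = "ball (0::complex) R"
  have usc: "usc_on ?D V" and fin: "\<forall>z\<in>?D. V z \<noteq> \<infinity>"
    using sub unfolding subharmonic_on_def by auto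
  have rD: "ball 0 r \<subseteq> ?D" "cball 0 r \<subseteq> ?D" using r by auto
  have contH: "continuous_on ?D H" using H by (rule has_dz_continuous_on)
  obtain B where B: "\<And>z. z \<in> cball 0 r \<Longrightarrow> V z < ereal B"
    using usc_on_bounded_above[OF usc open_ball fin compact_cball rD(2)] by blast
  have "compact (H ` cball 0 r)"
    using contH rD(2) by (intro compact_continuous_image continuous_on_subset[OF contH]) auto
  hence "bounded (H ` cball 0 r)" by (rule compact_imp_bounded)
  then obtain b where b: "\<And>z. z \<in> cball 0 r \<Longrightarrow> \<bar>H z\<bar> \<le> b"
    unfolding bounded_iff by (metis imageI real_norm_def)
  let ?f = "exp_diff r V H" and ?M = "exp (B + b)"
  have meas: "?f \<in> borel_measurable borel"
    by (rule exp_diff_measurable[OF usc open_ball contH rD(1)])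
  have nonneg: "0 \<le> ?f z" for z by (simp add: exp_diff_def)
  have bounded: "?f z \<le> ?M" for z
  proof (cases "z \<in> ball 0 r \<and> V z \<noteq> -\<infinity>")
    case True
    hence z: "z \<in> cball 0 r" by auto
    then obtain x where x: "V z = ereal x" using True B[OF z] by (cases "V z") auto
    have "x - H z \<le> B + b" using B[OF z] b[OF z] x by auto
    thus ?thesis using True x by (simp add: exp_diff_def)
  next
    case False
    thus ?thesis unfolding exp_diff_def by (simp only: if_False) simp
  qed
  have "bounded_submean ?f r ?M"
  proof
    fix a :: complex and s :: real
    assume s: "0 < s" "cball a s \<subseteq> ball 0 r"
    have "ennreal (?f a) * emeasure lborel (ball (0::complex) s) \<le> (\<integral>\<^sup>+u\<in>ball 0 s. ennreal (?f (a + u)) \<partial>lborel)"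
    proof (rule disk_integral_ge_of_circle_integral_ge)
      show "(\<lambda>z. ennreal (?f z)) \<in> borel_measurable borel" using meas by measurable
      fix t :: real assume t: "0 < t" "t < s"
      hence "cball a t \<subseteq> cball a s" by auto
      hence sub1: "cball a t \<subseteq> ball 0 r" "cball a t \<subseteq> ?D" using s rD by auto
      show "ennreal (2 * pi) * ennreal (?f a)
          \<le> (\<integral>\<^sup>+x\<in>{0..2 * pi}. ennreal (?f (a + of_real t * cis x)) \<partial>lborel)"
        by (rule exp_diff_circle[OF sub open_ball t(1) sub1(2) contH
              has_dz_circle_mean[OF g H open_ball convex_ball sub1(2) t(1)] sub1(1)])
    qed
    also have "(\<integral>\<^sup>+u\<in>ball 0 s. ennreal (?f (a + u)) \<partial>lborel)
        = (\<integral>\<^sup>+u. ennreal (?f (a + u) * indicator (ball 0 s) u) \<partial>lborel)"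
      by (intro nn_integral_cong) (auto simp: indicator_def)
    also have "\<dots> = ennreal (\<integral>u. ?f (a + u) * indicator (ball 0 s) u \<partial>lborel)"
    proof (rule nn_integral_eq_integral)
      show "integrable lborel (\<lambda>u. ?f (a + u) * indicator (ball 0 s) u)"
        by (rule integrable_lborel_bounded[where B = ?M and r = s])
           (use meas nonneg bounded in \<open>auto simp: indicator_def\<close>)
    qed (use nonneg in auto)
    also have "emeasure lborel (ball (0::complex) s) = ennreal (measure lborel (ball (0::complex) s))"
      using emeasure_bounded_finite[of "ball (0::complex) s"] by (intro emeasure_eq_ennreal_measure) auto
    also have "ennreal (?f a) * \<dots> = ennreal (?f a * measure lborel (ball (0::complex) s))"
      using nonneg by (simp add: ennreal_mult)
    finally show "?f a * measure lborel (ball (0::complex) s) \<le> (\<integral>u. ?f (a + u) * indicator (ball 0 s) u \<partial>lborel)"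
      using nonneg by (subst (asm) ennreal_le_iff) (auto intro!: Bochner_Integration.integral_nonneg)
  qed (use meas nonneg bounded exp_diff_usc[OF usc open_ball fin contH rD(1)] in \<open>auto simp: exp_diff_def\<close>)
  thus thesis by (rule that)
qed

text \<open>Since \<open>real_of_ereal\<close> sends a pole to 0, differentiability does not exclude
  poles outright. Near a pole in \<open>C\<close>, however, continuity keeps
  \<open>real_of_ereal (V z)\<close> above -1 while semicontinuity keeps \<open>V\<close> below -1,
  so \<open>V\<close> would be \<open>-\<infinity>\<close> on a whole neighbourhood.\<close>

lemma finite_of_dz_eq_on:
  assumes sub: "subharmonic_on D V" and D: "open D" "connected D"
    and C: "open C" "C \<subseteq> D" "dz_eq_on V g C" and a: "a \<in> C"
  shows "V a \<noteq> -\<infinity>"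
proof
  assume Va: "V a = -\<infinity>"
  let ?v = "\<lambda>w. real_of_ereal (V w)"
  have usc: "usc_on D V" using sub unfolding subharmonic_on_def by auto
  have cont: "continuous_on C ?v"
    using C(3) unfolding dz_eq_on_def by (intro has_dz_continuous_on[of _ _ g]) auto
  have "open (C \<inter> ?v -` {-1<..})" by (rule continuous_open_preimage[OF cont C(1)]) simp
  hence "open (C \<inter> ?v -` {-1<..} \<inter> {z \<in> D. V z < -1})" (is "open ?U")
    by (rule open_Int) (rule usc_on_open_less[OF usc D(1)])
  moreover have "a \<in> ?U" using a Va C(2) by auto
  moreover have "V z = -\<infinity>" if "z \<in> ?U" for z
    using that by (cases "V z") (auto simp: one_ereal_def)
  moreover have "?U \<subseteq> D" by auto
  ultimately show False using interior_minfinity_empty[OF sub D, of ?U] by blast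
qed


section \<open>Monotonicity along a cone\<close>

text \<open>The margin \<open>\<eta> * cmod x\<close>, instead of mere positivity, leaves room to
  perturb each \<open>a\<close> by less than \<open>\<eta>\<close>; so the condition at the origin
  passes to nearby points.\<close>

lemma exists_cone:
  assumes "finite A" "\<And>a. a \<in> A \<Longrightarrow> 0 < Re (a * \<xi>)"
  shows "\<exists>\<eta>>0. \<exists>\<kappa>>0. \<forall>x\<in>ball \<xi> \<kappa>. \<forall>a\<in>A. \<eta> * cmod x \<le> Re (a * x)"
  using assms
proof (induction A rule: finite_induct)
  case empty
  show ?case by (intro exI[of _ 1] conjI) auto
next
  case (insert a A)
  then obtain \<eta>' \<kappa>' where IH: "0 < \<eta>'" "0 < \<kappa>'"
    "\<And>x b. x \<in> ball \<xi> \<kappa>' \<Longrightarrow> b \<in> A \<Longrightarrow> \<eta>' * cmod x \<le> Re (b * x)" by auto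
  define d where "d = Re (a * \<xi>)"
  have d: "0 < d" using insert.prems by (simp add: d_def)
  hence a0: "0 < cmod a" by (auto simp: d_def)
  \<comment> \<open>\<open>d\<close> is spent in two halves: moving from \<open>\<xi>\<close> to
    \<open>x\<close> changes \<open>Re (a * x)\<close> by at most \<open>d / 2\<close>, and
    \<open>\<eta> * cmod x\<close> takes at most the other half.\<close>
  define \<kappa> where "\<kappa> = min \<kappa>' (d / (2 * cmod a))"
  define \<eta> where "\<eta> = min \<eta>' (d / (2 * (cmod \<xi> + \<kappa>)))"
  have \<kappa>: "0 < \<kappa>" "\<kappa> \<le> \<kappa>'" "cmod a * \<kappa> \<le> d / 2"
  proof -
    have "cmod a * \<kappa> \<le> cmod a * (d / (2 * cmod a))" unfolding \<kappa>_def by (intro mult_left_mono) auto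
    thus "cmod a * \<kappa> \<le> d / 2" using a0 by simp
  qed (use IH d a0 in \<open>auto simp: \<kappa>_def\<close>)
  have pos: "0 < cmod \<xi> + \<kappa>" using \<kappa>(1) by (intro add_nonneg_pos) auto
  have \<eta>: "0 < \<eta>" "\<eta> \<le> \<eta>'" "\<eta> * (cmod \<xi> + \<kappa>) \<le> d / 2"
  proof -
    have "\<eta> * (cmod \<xi> + \<kappa>) \<le> d / (2 * (cmod \<xi> + \<kappa>)) * (cmod \<xi> + \<kappa>)"
      unfolding \<eta>_def using pos by (intro mult_right_mono) auto
    moreover have "d / (2 * X) * X = d / 2" if "0 < X" for X using that by simp
    ultimately show "\<eta> * (cmod \<xi> + \<kappa>) \<le> d / 2" using pos by metis
  qed (use IH d pos in \<open>auto simp: \<eta>_def\<close>)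
  have "\<eta> * cmod x \<le> Re (b * x)" if x: "x \<in> ball \<xi> \<kappa>" and b: "b \<in> insert a A" for x b
  proof (cases "b = a")
    case True
    have dx: "cmod (x - \<xi>) < \<kappa>" using x by (simp add: dist_norm norm_minus_commute)
    have "\<bar>Re (a * (x - \<xi>))\<bar> \<le> cmod (a * (x - \<xi>))" by (rule abs_Re_le_cmod)
    also have "\<dots> \<le> cmod a * \<kappa>" using dx by (simp add: norm_mult mult_left_mono)
    finally have "\<bar>Re (a * (x - \<xi>))\<bar> \<le> d / 2" using \<kappa>(3) by linarith
    moreover have "Re (a * x) = d + Re (a * (x - \<xi>))" by (simp add: d_def algebra_simps)
    moreover have "cmod x \<le> cmod \<xi> + \<kappa>" using dx norm_triangle_ineq[of \<xi> "x - \<xi>"] by simp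
    hence "\<eta> * cmod x \<le> \<eta> * (cmod \<xi> + \<kappa>)" using \<eta>(1) by (intro mult_left_mono) auto
    ultimately show ?thesis unfolding True using \<eta>(3) by linarith
  next
    case False
    have "\<eta> * cmod x \<le> \<eta>' * cmod x" using \<eta>(2) by (intro mult_right_mono) auto
    also have "\<dots> \<le> Re (b * x)" using IH(3)[of x b] x b False \<kappa>(2) by auto
    finally show ?thesis .
  qed
  thus ?case using \<eta>(1) \<kappa>(1) by blast
qed

text \<open>Removing an extreme point from the hull leaves a convex set, so \<open>p\<close> is
  outside the compact hull of the other points and a line separates it strictly.\<close>

lemma extreme_point_separation:
  fixes S :: "complex set"
  assumes "finite S" "p extreme_point_of (convex hull S)"
  obtains \<xi> where "\<And>q. q \<in> S \<Longrightarrow> q \<noteq> p \<Longrightarrow> 0 < Re ((p - q) * \<xi>)"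
proof -
  have "convex (convex hull S - {p})"
    using assms(2) extreme_point_of_stillconvex[of "convex hull S" p] convex_convex_hull by blast
  moreover have "S - {p} \<subseteq> convex hull S - {p}" using hull_subset[of S convex] by blast
  ultimately have "convex hull (S - {p}) \<subseteq> convex hull S - {p}" by (rule hull_minimal[rotated])
  hence "p \<notin> convex hull (S - {p})" by blast
  moreover have "closed (convex hull (S - {p}))"
    using assms(1) by (intro compact_imp_closed compact_convex_hull finite_imp_compact) auto
  ultimately obtain a b where ab: "a \<bullet> p < b" "\<And>x. x \<in> convex hull (S - {p}) \<Longrightarrow> b < a \<bullet> x"
    using separating_hyperplane_closed_point[of "convex hull (S - {p})" p] convex_convex_hull by blast
  show thesis
  proof (rule that)
    fix q assume "q \<in> S" "q \<noteq> p"
    hence "b < a \<bullet> q" using ab(2) hull_subset[of "S - {p}" convex] by blast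
    \<comment> \<open>Here \<open>a \<bullet> q = Re (q * cnj a)\<close>; the minus sign accounts
      for \<open>p\<close> lying on the lower side of the line.\<close>
    thus "0 < Re ((p - q) * (- cnj a))" using ab(1) by (simp add: inner_complex_def algebra_simps)
  qed
qed

section \<open>Propagation of values along cones\<close>

context bounded_submean
begin

text \<open>A mean does not see null sets, so the mean value inequality carries an almost everywhere
  bound to every point.\<close>

lemma le_of_AE_le:
  assumes U: "open U" "a \<in> U" "U \<subseteq> ball 0 R" and ae: "AE z in lborel. z \<in> U \<longrightarrow> f z \<le> B" and B: "0 \<le> B"
  shows "f a \<le> B"
proof -
  obtain d where d: "0 < d" "cball a d \<subseteq> U" using U open_contains_cball by blast
  have ae': "AE u in lborel. a + u \<in> U \<longrightarrow> f (a + u) \<le> B"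
  proof -
    have "AE z in distr lborel borel ((+) a). z \<in> U \<longrightarrow> f z \<le> B"
      using ae unfolding lborel_distr_plus .
    moreover have [measurable]: "U \<in> sets borel" using U(1) by simp
    have "{z \<in> space borel. z \<in> U \<longrightarrow> f z \<le> B} \<in> sets borel" by measurable
    ultimately show ?thesis by (subst (asm) AE_distr_iff) auto
  qed
  have "f a * measure lborel (ball (0::complex) d) \<le> (\<integral>u. f (a + u) * indicator (ball 0 d) u \<partial>lborel)"
    using submean[OF d(1)] d(2) U(3) by blast
  also have "\<dots> \<le> (\<integral>u. B * indicator (ball (0::complex) d) u \<partial>lborel)"
  proof (rule integral_mono_AE)
    show "integrable lborel (\<lambda>u. f (a + u) * indicator (ball 0 d) u)"
      by (rule integrable_on_ball[where B = M]) (use nonneg bounded in auto)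
    show "integrable lborel (\<lambda>u. B * indicator (ball (0::complex) d) u)"
      by (rule integrable_on_ball[of "\<lambda>_. B" B]) (use B in auto)
    show "AE u in lborel. f (a + u) * indicator (ball 0 d) u \<le> B * indicator (ball 0 d) u"
      using ae'
    proof eventually_elim
      fix u assume u: "a + u \<in> U \<longrightarrow> f (a + u) \<le> B"
      show "f (a + u) * indicator (ball 0 d) u \<le> B * indicator (ball 0 d) u"
      proof (cases "u \<in> ball 0 d")
        case True
        hence "a + u \<in> cball a d" by (simp add: dist_norm)
        thus ?thesis using u True d(2) by auto
      qed simp
    qed
  qed
  also have "\<dots> = B * measure lborel (ball (0::complex) d)" by simp
  finally show ?thesis using d(1) by simp
qed

text \<open>Where \<open>f\<close> is locally constant it attains, by monotonicity, its maximum over a neighbourhood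
  of the cone with that vertex, so it is constant there.\<close>

lemma constant_on_cone:
  assumes \<rho>: "\<rho> \<le> R" and \<Gamma>: "convex \<Gamma>" "0 \<in> \<Gamma>"
    and anti: "\<And>z w. z \<in> ball 0 \<rho> \<Longrightarrow> w \<in> ball 0 \<rho> \<Longrightarrow> w - z \<in> \<Gamma> \<Longrightarrow> f w \<le> f z"
    and z: "z \<in> ball 0 \<rho>" "0 < d" "\<And>w. w \<in> ball z d \<Longrightarrow> f w = f z"
    and w: "w \<in> ball 0 \<rho>" "w - z \<in> \<Gamma>"
  shows "f w = f z"
proof -
  obtain e where e: "0 < e" "e \<le> d" "ball z e \<subseteq> ball 0 \<rho>"
  proof -
    obtain e' where "0 < e'" "ball z e' \<subseteq> ball 0 \<rho>" using z(1) open_contains_ball[of "ball 0 \<rho>"] by blast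
    hence "ball z (min e' d) \<subseteq> ball 0 \<rho>" using subset_ball[of "min e' d" e' z] by auto
    thus thesis using that[of "min e' d"] z(2) \<open>0 < e'\<close> by auto
  qed
  \<comment> \<open>As the sum of an open disk and \<open>\<Gamma>\<close>, this union of cones is
    open and convex and contains \<open>z\<close> as an interior point, which the single cone at
    \<open>z\<close> need not do.\<close>
  define S where "S = (\<Union>x\<in>ball z e. \<Union>y\<in>\<Gamma>. {x + y}) \<inter> ball 0 \<rho>"
  have mem: "x + y \<in> S" if "x \<in> ball z e" "y \<in> \<Gamma>" "x + y \<in> ball 0 \<rho>" for x y
    unfolding S_def using that by blast
  have "open S" unfolding S_def by (intro open_Int open_sums) auto
  moreover have "connected S"
    unfolding S_def by (intro convex_connected convex_Int convex_sums \<Gamma>(1)) auto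
  moreover have "S \<subseteq> ball 0 R" using \<rho> by (auto simp: S_def)
  moreover have "z \<in> S" using mem[of z 0] z(1) e(1) \<Gamma>(2) by simp
  moreover have "f s \<le> f z" if s: "s \<in> S" for s
  proof -
    obtain x y where xy: "x \<in> ball z e" "y \<in> \<Gamma>" "s = x + y" "s \<in> ball 0 \<rho>" using s by (auto simp: S_def)
    hence "f s \<le> f x" using e(3) by (intro anti) auto
    also have "f x = f z" using xy(1) e(2) z(3)[of x] by simp
    finally show ?thesis .
  qed
  moreover have "w \<in> S" using mem[of z "w - z"] w e(1) by simp
  ultimately show ?thesis by (rule maximum_principle)
qed

text \<open>As \<open>\<xi>\<close> is interior to \<open>\<Gamma>\<close>, all cones with vertices
  in a small disk about 0 contain \<open>z + t \<xi>\<close> for every \<open>z\<close> of the disk.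
  A common point forces one value \<open>c\<close> on the vertices in \<open>U\<close>, and
  monotonicity from \<open>z\<close> to \<open>z + t \<xi>\<close> gives \<open>c \<le> f z\<close>.
  A point of the ray lies in the cone of every vertex close enough to 0.\<close>

lemma constant_near_vertex:
  assumes \<rho>: "0 < \<rho>" "\<rho> \<le> R" and \<Gamma>: "convex \<Gamma>" "\<And>t x. 0 \<le> t \<Longrightarrow> x \<in> \<Gamma> \<Longrightarrow> t *\<^sub>R x \<in> \<Gamma>"
    and \<xi>: "0 < \<kappa>" "ball \<xi> \<kappa> \<subseteq> \<Gamma>"
    and anti: "\<And>z w. z \<in> ball 0 \<rho> \<Longrightarrow> w \<in> ball 0 \<rho> \<Longrightarrow> w - z \<in> \<Gamma> \<Longrightarrow> f w \<le> f z"
    and U: "0 \<in> closure U"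
    and const: "\<And>z. z \<in> U \<Longrightarrow> z \<in> ball 0 \<rho> \<Longrightarrow> \<exists>d>0. \<forall>w\<in>ball z d. f w = f z"
    and pos: "\<And>z. z \<in> U \<Longrightarrow> z \<in> ball 0 \<rho> \<Longrightarrow> 0 < f z"
  obtains r c s where "0 < r" "r \<le> \<rho>" "0 < c" "0 < s"
    "\<And>z. z \<in> ball 0 r \<Longrightarrow> c \<le> f z"
    "\<And>z. z \<in> U \<Longrightarrow> z \<in> ball 0 r \<Longrightarrow> f z = c"
    "\<And>t. 0 < t \<Longrightarrow> t < s \<Longrightarrow> f (t *\<^sub>R \<xi>) = c"
proof -
  have \<xi>\<Gamma>: "\<xi> \<in> \<Gamma>" using \<xi> by auto
  have 0: "0 \<in> \<Gamma>" using \<Gamma>(2)[of 0 \<xi>] \<xi>\<Gamma> by simp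
  have cone: "t *\<^sub>R \<xi> + v \<in> \<Gamma>" if "0 < t" "cmod v < t * \<kappa>" for t v
  proof -
    have "cmod (v /\<^sub>R t) < \<kappa>" using that by (simp add: divide_less_eq mult.commute inverse_eq_divide)
    hence "\<xi> + v /\<^sub>R t \<in> \<Gamma>" using \<xi>(2) by (intro subsetD[OF \<xi>(2)]) (simp add: dist_norm)
    from \<Gamma>(2)[OF _ this, of t] show ?thesis using that by (simp add: algebra_simps)
  qed
  have P: "f w = f z" if zw: "z \<in> U" "z \<in> ball 0 \<rho>" "w \<in> ball 0 \<rho>" "w - z \<in> \<Gamma>" for z w
  proof -
    obtain d where "d > 0" "\<forall>w\<in>ball z d. f w = f z" using const[OF zw(1,2)] by blast
    thus ?thesis using constant_on_cone[OF \<rho>(2) \<Gamma>(1) 0 anti zw(2), of d w] zw(3,4) by blast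
  qed
  \<comment> \<open>With \<open>t * \<kappa> = 2 * r\<close> the opening at \<open>t \<xi>\<close>
    absorbs the difference of any two points of \<open>ball 0 r\<close>; \<open>q\<close> is chosen
    so that \<open>r + t |\<xi>| = r * q = \<rho> / 2\<close>.\<close>
  define q where "q = 1 + 2 * cmod \<xi> / \<kappa>"
  have q: "1 \<le> q" using \<xi>(1) by (simp add: q_def)
  define r where "r = \<rho> / (2 * q)"
  have rq: "r * q = \<rho> / 2" using q by (simp add: r_def)
  have r: "0 < r" "r \<le> \<rho>"
  proof -
    show r0: "0 < r" using q \<rho>(1) by (simp add: r_def)
    have "r * 1 \<le> r * q" using q r0 by (intro mult_left_mono) auto
    thus "r \<le> \<rho>" using rq \<rho>(1) by simp
  qed
  define t where "t = 2 * r / \<kappa>"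
  have t: "0 < t" "t * \<kappa> = 2 * r" using r(1) \<xi>(1) by (auto simp: t_def)
  have shift: "z + t *\<^sub>R \<xi> \<in> ball 0 \<rho>" if "z \<in> ball 0 r" for z
  proof -
    have "cmod (z + t *\<^sub>R \<xi>) \<le> cmod z + t * cmod \<xi>" using norm_triangle_ineq[of z "t *\<^sub>R \<xi>"] t(1) by simp
    also have "\<dots> \<le> r + t * cmod \<xi>" using that by simp
    also have "\<dots> = r * q" by (simp add: t_def q_def distrib_left)
    also have "\<dots> < \<rho>" using rq \<rho>(1) by simp
    finally show ?thesis by simp
  qed
  have shift_cone: "z + t *\<^sub>R \<xi> - z' \<in> \<Gamma>" if "z \<in> ball 0 r" "z' \<in> ball 0 r" for z z'
  proof -
    have "cmod (z - z') < t * \<kappa>" unfolding t(2) using that norm_triangle_ineq4[of z z'] by simp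
    from cone[OF t(1) this] show ?thesis by (simp add: algebra_simps)
  qed
  have near: "\<exists>z\<in>U. cmod z < e" if "0 < e" for e
    using U that unfolding closure_approachable by (auto simp: dist_norm)
  obtain z1 where z1: "z1 \<in> U" "z1 \<in> ball 0 r" using near[OF r(1)] by auto
  have in_\<rho>: "z \<in> ball 0 \<rho>" if "z \<in> ball 0 r" for z using that r by simp
  define c where "c = f z1"
  define s where "s = \<rho> / (cmod \<xi> + 1)"
  have Uc: "f z = c" if "z \<in> U" "z \<in> ball 0 r" for z
    using P[OF that(1) in_\<rho>[OF that(2)] shift[OF z1(2)] shift_cone[OF z1(2) that(2)]]
      P[OF z1(1) in_\<rho>[OF z1(2)] shift[OF z1(2)] shift_cone[OF z1(2) z1(2)]] by (simp add: c_def)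
  show thesis
  proof (rule that[OF r, of c s])
    show "0 < c" using pos[OF z1(1) in_\<rho>[OF z1(2)]] by (simp add: c_def)
    show "0 < s" using \<rho>(1) by (simp add: s_def add_nonneg_pos)
    show "c \<le> f z" if z: "z \<in> ball 0 r" for z
    proof -
      have "c = f (z + t *\<^sub>R \<xi>)"
        using P[OF z1(1) in_\<rho>[OF z1(2)] shift[OF z] shift_cone[OF z z1(2)]] by (simp add: c_def)
      also have "\<dots> \<le> f z"
        using \<Gamma>(2)[of t \<xi>] \<xi>\<Gamma> t(1) by (intro anti in_\<rho>[OF z] shift[OF z]) auto
      finally show ?thesis .
    qed
    show "f (u *\<^sub>R \<xi>) = c" if u: "0 < u" "u < s" for u
    proof -
      obtain z2 where z2: "z2 \<in> U" "cmod z2 < min r (u * \<kappa>)" using near[of "min r (u * \<kappa>)"] r u \<xi> by auto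
      have "u * cmod \<xi> \<le> u * (cmod \<xi> + 1)" using u by (intro mult_left_mono) auto
      also have "\<dots> < s * (cmod \<xi> + 1)" using u by (intro mult_strict_right_mono) (auto simp: add_nonneg_pos)
      also have "\<dots> = \<rho>" by (simp add: s_def add_nonneg_eq_0_iff)
      finally have "u *\<^sub>R \<xi> \<in> ball 0 \<rho>" using u by simp
      moreover have "u *\<^sub>R \<xi> - z2 \<in> \<Gamma>" using cone[of u "- z2"] u z2 by simp
      moreover have z2r: "z2 \<in> ball 0 r" using z2 by simp
      ultimately show ?thesis using P[OF z2(1) in_\<rho>[OF z2r], of "u *\<^sub>R \<xi>"] Uc[OF z2(1) z2r] by simp
    qed
  qed (use Uc in auto)
qed

lemma antitone_of_derivative:
  assumes \<rho>: "0 < \<rho>" "2 * \<rho> \<le> R"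
    and deriv: "AE z in lborel. z \<in> ball 0 (\<rho> / 4) \<longrightarrow> (\<exists>F. (f has_derivative F) (at z) \<and> F h \<le> 0)"
    and a: "cmod a < \<rho> / 8" "cmod (a + h) < \<rho> / 8"
  shows "f (a + h) \<le> f a"
proof (rule antitone[OF \<rho> a])
  show "AE z in lborel. z \<in> ball 0 (\<rho> / 4) \<longrightarrow>
      (\<lambda>n. max 0 (real (Suc n) * (f (z + h /\<^sub>R real (Suc n)) - f z))) \<longlonglongrightarrow> 0"
    using deriv
  proof (eventually_elim, intro impI)
    fix z assume "z \<in> ball 0 (\<rho> / 4) \<longrightarrow> (\<exists>F. (f has_derivative F) (at z) \<and> F h \<le> 0)" "z \<in> ball 0 (\<rho> / 4)"
    then obtain F where F: "(f has_derivative F) (at z)" "F h \<le> 0" by blast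
    have "((\<lambda>t::real. z + t *\<^sub>R h) has_derivative (\<lambda>t. t *\<^sub>R h)) (at 0)"
      by (auto intro!: derivative_eq_intros)
    from has_derivative_compose[OF this, of f F]
    have "((\<lambda>t. f (z + t *\<^sub>R h)) has_derivative (\<lambda>t. F (t *\<^sub>R h))) (at 0)" using F(1) by simp
    moreover have "F (t *\<^sub>R h) = F h * t" for t
      using linear_scale[OF has_derivative_linear[OF F(1)]] by simp
    ultimately have "((\<lambda>t. f (z + t *\<^sub>R h)) has_field_derivative F h) (at 0)"
      by (simp add: has_field_derivative_def mult_commute_abs)
    hence "((\<lambda>t. (f (z + t *\<^sub>R h) - f z) / t) \<longlongrightarrow> F h) (at 0)" by (simp add: DERIV_def)
    moreover have "filterlim (\<lambda>n. inverse (real (Suc n))) (at 0) sequentially"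
      using LIMSEQ_inverse_real_of_nat by (simp add: filterlim_at)
    ultimately have "(\<lambda>n. (f (z + inverse (real (Suc n)) *\<^sub>R h) - f z) / inverse (real (Suc n))) \<longlonglongrightarrow> F h"
      by (rule filterlim_compose)
    hence "(\<lambda>n. max 0 (real (Suc n) * (f (z + h /\<^sub>R real (Suc n)) - f z))) \<longlonglongrightarrow> max 0 (F h)"
      by (intro tendsto_max tendsto_const) (simp add: divide_inverse mult.commute del: of_nat_Suc)
    thus "(\<lambda>n. max 0 (real (Suc n) * (f (z + h /\<^sub>R real (Suc n)) - f z))) \<longlonglongrightarrow> 0" using F(2) by simp
  qed
qed

end


section \<open>Local structure of piecewise harmonic subharmonic functions\<close>

text \<open>The analysis for one index, with distributions replaced by open connected sets on which
  \<open>\<partial>V/\<partial>z\<close> is some \<open>g j\<close>. The ray along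
  \<open>\<xi>\<close> belongs to the conclusion because \<open>V\<close> is known exactly on it up
  to the origin, as the comparison of constants requires.\<close>

lemma dominant_phase:
  fixes V :: "complex \<Rightarrow> ereal" and g :: "'i \<Rightarrow> complex \<Rightarrow> complex" and H :: "'i \<Rightarrow> complex \<Rightarrow> real"
  assumes R: "0 < R" and sub: "subharmonic_on (ball 0 R) V" and I: "finite I" "i \<in> I"
    and g: "\<And>j. j \<in> I \<Longrightarrow> g j holomorphic_on ball 0 R"
    and H: "\<And>j z. j \<in> I \<Longrightarrow> z \<in> ball 0 R \<Longrightarrow> has_dz (H j) (g j z) z"
    and cov: "AE z in lborel. z \<in> ball 0 R \<longrightarrow>
      (\<exists>j\<in>I. \<exists>C. open C \<and> connected C \<and> z \<in> C \<and> C \<subseteq> ball 0 R \<and> dz_eq_on V (g j) C)"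
    and U: "\<And>z. z \<in> U \<Longrightarrow> \<exists>C. open C \<and> connected C \<and> z \<in> C \<and> C \<subseteq> ball 0 R \<and> dz_eq_on V (g i) C"
    and U0: "0 \<in> closure U"
    and inj: "inj_on (\<lambda>j. g j 0) I"
    and ext: "g i 0 extreme_point_of (convex hull ((\<lambda>j. g j 0) ` I))"
  obtains r c s \<xi> where "0 < r" "r \<le> R" "0 < s"
    "\<And>z. z \<in> ball 0 r \<Longrightarrow> V z \<noteq> -\<infinity> \<and> H i z + c \<le> real_of_ereal (V z)"
    "\<And>z. z \<in> U \<Longrightarrow> z \<in> ball 0 r \<Longrightarrow> real_of_ereal (V z) = H i z + c"
    "\<And>t. 0 < t \<Longrightarrow> t < s \<Longrightarrow> real_of_ereal (V (t *\<^sub>R \<xi>)) = H i (t *\<^sub>R \<xi>) + c"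
proof -
  define r0 where "r0 = R / 2"
  have r0: "0 < r0" "r0 < R" using R by (auto simp: r0_def)
  define f where "f = exp_diff r0 V (H i)"
  let ?v = "\<lambda>z. real_of_ereal (V z)"
  obtain M where "bounded_submean f r0 M"
    using bounded_submean_exp_diff[OF sub r0 g[OF I(2)] H[OF I(2)]] unfolding f_def by blast
  then interpret bounded_submean f r0 M .
  have fin: "V z \<noteq> -\<infinity>" if "open C" "C \<subseteq> ball 0 R" "dz_eq_on V d C" "z \<in> C" for C d z
    using finite_of_dz_eq_on[OF sub open_ball convex_connected[OF convex_ball] that] .
  have f_eq: "f z = exp (?v z - H i z)" if "z \<in> ball 0 r0" "V z \<noteq> -\<infinity>" for z
    using that by (simp add: f_def exp_diff_def)
  define A where "A = (\<lambda>j. g i 0 - g j 0) ` (I - {i})"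
  obtain \<xi> where \<xi>: "\<And>q. q \<in> (\<lambda>j. g j 0) ` I \<Longrightarrow> q \<noteq> g i 0 \<Longrightarrow> 0 < Re ((g i 0 - q) * \<xi>)"
    using extreme_point_separation[OF _ ext] I(1) by blast
  have "0 < Re (a * \<xi>)" if "a \<in> A" for a
  proof -
    from that obtain j where j: "j \<in> I" "j \<noteq> i" "a = g i 0 - g j 0" by (auto simp: A_def)
    hence "g j 0 \<noteq> g i 0" using inj I(2) by (auto dest: inj_onD)
    thus ?thesis using \<xi>[of "g j 0"] j by auto
  qed
  moreover have "finite A" using I(1) by (simp add: A_def)
  ultimately obtain \<eta> \<kappa> where \<eta>: "0 < \<eta>" and \<kappa>: "0 < \<kappa>"
    and cone: "\<And>x a. x \<in> ball \<xi> \<kappa> \<Longrightarrow> a \<in> A \<Longrightarrow> \<eta> * cmod x \<le> Re (a * x)"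
    using exists_cone[of A \<xi>] by metis
  define \<Gamma> where "\<Gamma> = {x. \<forall>a\<in>A. \<eta> * cmod x \<le> Re (a * x)}"
  have \<Gamma>_convex: "convex \<Gamma>"
  proof (rule convexI)
    fix x y and u v :: real assume xy: "x \<in> \<Gamma>" "y \<in> \<Gamma>" and uv: "0 \<le> u" "0 \<le> v"
    have "\<eta> * cmod (u *\<^sub>R x + v *\<^sub>R y) \<le> Re (a * (u *\<^sub>R x + v *\<^sub>R y))" if "a \<in> A" for a
    proof -
      have "\<eta> * cmod (u *\<^sub>R x + v *\<^sub>R y) \<le> \<eta> * (u * cmod x + v * cmod y)"
        using norm_triangle_ineq[of "u *\<^sub>R x" "v *\<^sub>R y"] uv \<eta> by (intro mult_left_mono) auto
      also have "\<dots> = u * (\<eta> * cmod x) + v * (\<eta> * cmod y)" by (simp add: algebra_simps)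
      also have "\<dots> \<le> u * Re (a * x) + v * Re (a * y)"
        using xy uv that by (intro add_mono mult_left_mono) (auto simp: \<Gamma>_def)
      also have "\<dots> = Re (a * (u *\<^sub>R x + v *\<^sub>R y))" by (simp add: algebra_simps)
      finally show ?thesis .
    qed
    thus "u *\<^sub>R x + v *\<^sub>R y \<in> \<Gamma>" by (simp add: \<Gamma>_def)
  qed
  have \<Gamma>_scale: "t *\<^sub>R x \<in> \<Gamma>" if "0 \<le> t" "x \<in> \<Gamma>" for t x
  proof -
    have "\<eta> * cmod (t *\<^sub>R x) \<le> Re (a * (t *\<^sub>R x))" if "a \<in> A" for a
    proof -
      have "t * (\<eta> * cmod x) \<le> t * Re (a * x)"
        using \<open>x \<in> \<Gamma>\<close> \<open>0 \<le> t\<close> that by (intro mult_left_mono) (auto simp: \<Gamma>_def)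
      thus ?thesis using \<open>0 \<le> t\<close> by (simp add: algebra_simps)
    qed
    thus ?thesis unfolding \<Gamma>_def by blast
  qed
  have \<xi>\<Gamma>: "ball \<xi> \<kappa> \<subseteq> \<Gamma>" using cone by (auto simp: \<Gamma>_def)
  have "\<forall>\<^sub>F z in nhds 0. \<forall>j\<in>I. cmod ((g i z - g j z) - (g i 0 - g j 0)) < \<eta>"
  proof (rule eventually_ball_finite[OF I(1)], intro ballI)
    fix j assume j: "j \<in> I"
    have "isCont (g k) 0" if "k \<in> I" for k
      using holomorphic_on_imp_continuous_on[OF g[OF that]] R
      by (simp add: continuous_on_eq_continuous_at)
    hence "isCont (\<lambda>z. g i z - g j z) 0" using j I(2) by (intro continuous_diff) auto
    hence "((\<lambda>z. g i z - g j z) \<longlongrightarrow> g i 0 - g j 0) (nhds 0)" by (simp add: isCont_def tendsto_nhds_iff)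
    from tendstoD[OF this \<eta>] show "\<forall>\<^sub>F z in nhds 0. cmod ((g i z - g j z) - (g i 0 - g j 0)) < \<eta>"
      by (simp add: dist_norm)
  qed
  then obtain \<delta> where \<delta>: "0 < \<delta>"
    "\<And>z j. cmod z < \<delta> \<Longrightarrow> j \<in> I \<Longrightarrow> cmod ((g i z - g j z) - (g i 0 - g j 0)) < \<eta>"
    unfolding eventually_nhds_metric by (auto simp: dist_norm)
  \<comment> \<open>\<open>\<delta>\<close> keeps \<open>g i - g j\<close> within
    \<open>\<eta>\<close> of its value at 0, the margin built into \<open>\<Gamma>\<close>;
    \<open>R / 4\<close> ensures \<open>2 * \<sigma> \<le> r0\<close>, as the energy estimate
    demands.\<close>
  define \<sigma> where "\<sigma> = min \<delta> (R / 4)"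
  have \<sigma>: "0 < \<sigma>" "\<sigma> \<le> \<delta>" "2 * \<sigma> \<le> r0" using \<delta> R by (auto simp: \<sigma>_def r0_def)
  have deriv: "AE z in lborel. z \<in> ball 0 (\<sigma> / 4) \<longrightarrow> (\<exists>F. (f has_derivative F) (at z) \<and> F h \<le> 0)"
    if h: "h \<in> \<Gamma>" for h
    using cov
  proof (eventually_elim, intro impI)
    fix z
    assume ex: "z \<in> ball 0 R \<longrightarrow>
        (\<exists>j\<in>I. \<exists>C. open C \<and> connected C \<and> z \<in> C \<and> C \<subseteq> ball 0 R \<and> dz_eq_on V (g j) C)"
      and z: "z \<in> ball 0 (\<sigma> / 4)"
    have z': "z \<in> ball 0 r0" "z \<in> ball 0 R" "cmod z < \<delta>" using z \<sigma> r0 by auto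
    obtain j C where j: "j \<in> I" and C: "open C" "z \<in> C" "C \<subseteq> ball 0 R" "dz_eq_on V (g j) C"
      using ex z'(2) by blast
    have "(?v has_derivative (\<lambda>h. 2 * Re (g j z * h))) (at z)"
      using C(2,4) unfolding dz_eq_on_def by (intro has_dz_imp_has_derivative) auto
    moreover have "(H i has_derivative (\<lambda>h. 2 * Re (g i z * h))) (at z)"
      by (rule has_dz_imp_has_derivative[OF H[OF I(2) z'(2)]])
    ultimately have "((\<lambda>w. exp (?v w - H i w)) has_derivative
        (\<lambda>h. (2 * Re (g j z * h) - 2 * Re (g i z * h)) * exp (?v z - H i z))) (at z)"
      by (intro has_derivative_exp has_derivative_diff)
    \<comment> \<open>By \<open>fin\<close> there are no poles in \<open>C\<close>, so near
      \<open>z\<close> the function \<open>f\<close> is the exponential itself.\<close>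
    hence "(f has_derivative (\<lambda>h. (2 * Re (g j z * h) - 2 * Re (g i z * h)) * exp (?v z - H i z))) (at z)"
      by (rule has_derivative_transform_within_open[of _ _ _ _ "C \<inter> ball 0 r0"])
         (use C z' fin[OF C(1,3,4)] f_eq in auto)
    moreover have "0 \<le> Re ((g i z - g j z) * h)"
    proof (cases "j = i")
      case False
      hence "g i 0 - g j 0 \<in> A" using j by (auto simp: A_def)
      hence "\<eta> * cmod h \<le> Re ((g i 0 - g j 0) * h)" using h by (auto simp: \<Gamma>_def)
      moreover have "\<bar>Re (((g i z - g j z) - (g i 0 - g j 0)) * h)\<bar> \<le> \<eta> * cmod h"
      proof -
        have "\<bar>Re (((g i z - g j z) - (g i 0 - g j 0)) * h)\<bar> \<le> cmod (((g i z - g j z) - (g i 0 - g j 0)) * h)"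
          by (rule abs_Re_le_cmod)
        also have "\<dots> \<le> \<eta> * cmod h"
          unfolding norm_mult using \<delta>(2)[OF z'(3) j] by (intro mult_right_mono) auto
        finally show ?thesis .
      qed
      moreover have "Re ((g i z - g j z) * h)
          = Re ((g i 0 - g j 0) * h) + Re (((g i z - g j z) - (g i 0 - g j 0)) * h)"
        by (simp add: algebra_simps)
      ultimately show ?thesis by linarith
    qed simp
    hence "2 * Re (g j z * h) - 2 * Re (g i z * h) \<le> 0" by (simp add: algebra_simps)
    hence "(2 * Re (g j z * h) - 2 * Re (g i z * h)) * exp (?v z - H i z) \<le> 0"
      by (intro mult_nonpos_nonneg) auto
    ultimately show "\<exists>F. (f has_derivative F) (at z) \<and> F h \<le> 0" by blast
  qed
  define \<rho> where "\<rho> = \<sigma> / 8"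
  have \<rho>: "0 < \<rho>" "\<rho> \<le> r0" using \<sigma> by (auto simp: \<rho>_def)
  have anti: "f w \<le> f z" if "z \<in> ball 0 \<rho>" "w \<in> ball 0 \<rho>" "w - z \<in> \<Gamma>" for z w
    using antitone_of_derivative[OF \<sigma>(1,3) deriv[OF that(3)], of z] that(1,2) by (simp add: \<rho>_def)
  have const: "0 < f z \<and> (\<exists>d>0. \<forall>w\<in>ball z d. f w = f z)" if z: "z \<in> U" "z \<in> ball 0 \<rho>" for z
  proof -
    obtain C where C: "open C" "connected C" "z \<in> C" "C \<subseteq> ball 0 R" "dz_eq_on V (g i) C"
      using U[OF z(1)] by blast
    obtain c where c: "\<And>w. w \<in> C \<Longrightarrow> ?v w - H i w = c"
      using has_dz_diff_constant[OF C(1,2), of ?v "g i" "H i"] C(4,5) H[OF I(2)]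
      unfolding dz_eq_on_def by blast
    have fc: "f w = exp c" if "w \<in> C \<inter> ball 0 r0" for w
      using f_eq[of w] fin[OF C(1,4,5), of w] c[of w] that by auto
    have zC: "z \<in> C \<inter> ball 0 r0" using C(3) z(2) \<rho> by auto
    then obtain d where "0 < d" "ball z d \<subseteq> C \<inter> ball 0 r0"
      using open_contains_ball[of "C \<inter> ball 0 r0"] C(1) by blast
    thus ?thesis using fc zC by (metis exp_gt_zero subsetD)
  qed
  have const1: "\<exists>d>0. \<forall>w\<in>ball z d. f w = f z" and const2: "0 < f z" if "z \<in> U" "z \<in> ball 0 \<rho>" for z
    using const[OF that] by blast+
  obtain r c s where rcs: "0 < r" "r \<le> \<rho>" "0 < c" "0 < s"
    "\<And>z. z \<in> ball 0 r \<Longrightarrow> c \<le> f z"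
    "\<And>z. z \<in> U \<Longrightarrow> z \<in> ball 0 r \<Longrightarrow> f z = c"
    "\<And>t. 0 < t \<Longrightarrow> t < s \<Longrightarrow> f (t *\<^sub>R \<xi>) = c"
    using constant_near_vertex[OF \<rho> \<Gamma>_convex \<Gamma>_scale \<kappa> \<xi>\<Gamma> anti U0 const1 const2] by blast
  have f_pos: "V z \<noteq> -\<infinity> \<and> f z = exp (?v z - H i z)" if "0 < f z" for z
    using that unfolding f_def exp_diff_def by (auto split: if_splits)
  show thesis
  proof (rule that[of r s "ln c" \<xi>])
    show "0 < r" "r \<le> R" "0 < s" using rcs \<rho> r0 by auto
    show "V z \<noteq> -\<infinity> \<and> H i z + ln c \<le> ?v z" if "z \<in> ball 0 r" for z
    proof -
      have fz: "c \<le> f z" using rcs(5)[OF that] .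
      hence V: "V z \<noteq> -\<infinity>" "f z = exp (?v z - H i z)" using f_pos[of z] rcs(3) by auto
      hence "exp (ln c) \<le> exp (?v z - H i z)" using fz rcs(3) by simp
      hence "ln c \<le> ?v z - H i z" by (simp only: exp_le_cancel_iff)
      thus ?thesis using V(1) by simp
    qed
    have ln_eq: "?v z = H i z + ln c" if "f z = c" for z
      using f_pos[of z] that rcs(3) by (metis add.commute diff_add_cancel ln_exp)
    show "?v z = H i z + ln c" if "z \<in> U" "z \<in> ball 0 r" for z
      using ln_eq rcs(6)[OF that] by blast
    show "?v (t *\<^sub>R \<xi>) = H i (t *\<^sub>R \<xi>) + ln c" if "0 < t" "t < s" for t
      using ln_eq rcs(7)[OF that] by blast
  qed
qed

section \<open>Gluing the phases into a maximum\<close>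

theorem theorem1p5:
  fixes R :: real and D K :: "complex set" and V :: "complex \<Rightarrow> ereal"
    and k :: nat and g :: "nat \<Rightarrow> complex \<Rightarrow> complex"
    and U :: "nat \<Rightarrow> complex set" and H :: "nat \<Rightarrow> complex \<Rightarrow> real"
  assumes "R > 0" and "D = ball 0 R"
    and "V \<in> SH0 D"
    and "\<And>\<nu>. \<nu> \<in> {1..k} \<Longrightarrow> g \<nu> holomorphic_on D"
    and "dz_piecewise_holomorphic D V k g"
    and "K = supp_laplacian D V"
    and "\<And>\<nu>. \<nu> \<in> {1..k} \<Longrightarrow> U \<nu> = \<Union>{C \<in> components (D - K). dz_eq_on V (g \<nu>) C}"
    and "\<And>\<nu>. \<nu> \<in> {1..k} \<Longrightarrow> 0 \<in> closure (U \<nu>)"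
    and "inj_on (\<lambda>\<nu>. g \<nu> 0) {1..k}"
    and "\<And>i. i \<in> {1..k} \<Longrightarrow> g i 0 extreme_point_of (convex hull ((\<lambda>\<nu>. g \<nu> 0) ` {1..k}))"
    and "\<And>\<nu>. \<nu> \<in> {1..k} \<Longrightarrow> harmonic_on (H \<nu>) D"
    and "\<And>\<nu> z. \<nu> \<in> {1..k} \<Longrightarrow> z \<in> D \<Longrightarrow> has_dz (H \<nu>) (g \<nu> z) z"
    and "\<And>\<nu>. \<nu> \<in> {1..k} \<Longrightarrow> H \<nu> 0 = 0"
  shows "\<exists>c::real. \<forall>\<^sub>F z in nhds 0. V z = ereal (Max ((\<lambda>\<nu>. H \<nu> z) ` {1..k}) + c)"
proof -
  let ?I = "{1..k}" and ?v = "\<lambda>z. real_of_ereal (V z)"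
  note R = assms(1) and g = assms(4)[unfolded assms(2)] and H = assms(12)[unfolded assms(2)]
  have sub: "subharmonic_on (ball 0 R) V" and K: "K \<in> null_sets lebesgue"
    using assms(2,3,6) by (auto simp: SH0_def)
  have V_fin: "V z \<noteq> \<infinity>" if "z \<in> ball 0 R" for z using sub that unfolding subharmonic_on_def by auto
  have "open (D - K)"
  proof (subst open_subopen, intro ballI)
    fix z assume "z \<in> D - K"
    then obtain W where W: "open W" "z \<in> W" "W \<subseteq> D"
      "\<And>\<phi>. test_function_on W \<phi> \<Longrightarrow> dist_laplacian D V \<phi> = 0"
      unfolding assms(6) supp_laplacian_def dist_support_def by blast
    \<comment> \<open>The set \<open>W\<close> that shows \<open>z\<close> to be outside the support
      does so for each of its points.\<close>
    have "W \<inter> K = {}"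
      using W unfolding assms(6) supp_laplacian_def dist_support_def by blast
    thus "\<exists>T. open T \<and> z \<in> T \<and> T \<subseteq> D - K" using W by blast
  qed
  hence comp: "open C" "connected C" "C \<subseteq> ball 0 R" if "C \<in> components (D - K)" for C
    using that open_components in_components_connected in_components_subset[OF that] assms(2) by blast+
  have AE_K: "AE z in lborel. z \<notin> K"
    using AE_not_in[OF K] by (simp add: AE_completion_iff)
  have in_comp: "\<exists>j\<in>?I. \<exists>C\<in>components (D - K). z \<in> C \<and> dz_eq_on V (g j) C" if z: "z \<in> D - K" for z
  proof -
    obtain C where "C \<in> components (D - K)" "z \<in> C" using z Union_components[of "D - K"] by blast
    thus ?thesis using assms(5) unfolding dz_piecewise_holomorphic_def assms(6) by blast
  qed
  have cov: "AE z in lborel. z \<in> ball 0 R \<longrightarrow>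
      (\<exists>j\<in>?I. \<exists>C. open C \<and> connected C \<and> z \<in> C \<and> C \<subseteq> ball 0 R \<and> dz_eq_on V (g j) C)"
    using AE_K
  proof (eventually_elim, intro impI)
    fix z assume "z \<notin> K" "z \<in> ball 0 R"
    hence "z \<in> D - K" using assms(2) by simp
    from in_comp[OF this] comp show "\<exists>j\<in>?I. \<exists>C. open C \<and> connected C \<and> z \<in> C \<and> C \<subseteq> ball 0 R \<and> dz_eq_on V (g j) C"
      by blast
  qed
  \<comment> \<open>A point off \<open>K\<close> lies in a component, whose index shows that
    \<open>k\<close> is at least 1; the maximum is over a nonempty set.\<close>
  obtain z0 where "z0 \<in> ball 0 R" "z0 \<notin> K"
    using AE_lborel_open_ex[OF AE_K open_ball, of 0 R] R by auto
  hence "?I \<noteq> {}" using in_comp[of z0] assms(2) by auto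
  hence one: "1 \<in> ?I" by auto
  define P where "P i r c s \<xi> \<longleftrightarrow> 0 < r \<and> r \<le> R \<and> 0 < s \<and>
      (\<forall>z\<in>ball 0 r. V z \<noteq> -\<infinity> \<and> H i z + c \<le> ?v z) \<and>
      (\<forall>z\<in>U i. z \<in> ball 0 r \<longrightarrow> ?v z = H i z + c) \<and>
      (\<forall>t. 0 < t \<and> t < s \<longrightarrow> ?v (t *\<^sub>R \<xi>) = H i (t *\<^sub>R \<xi>) + c)" for i r c s \<xi>
  have phase: "\<exists>r c s \<xi>. P i r c s \<xi>" if i: "i \<in> ?I" for i
  proof -
    have Ui: "\<exists>C. open C \<and> connected C \<and> z \<in> C \<and> C \<subseteq> ball 0 R \<and> dz_eq_on V (g i) C" if "z \<in> U i" for z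
      using that comp unfolding assms(7)[OF i] by blast
    show ?thesis unfolding P_def
      by (rule dominant_phase[OF R sub finite_atLeastAtMost i g H cov Ui assms(8)[OF i] assms(9) assms(10)[OF i]])
         blast+
  qed
  obtain r c s \<xi> where P: "\<And>i. i \<in> ?I \<Longrightarrow> P i (r i) (c i) (s i) (\<xi> i)"
    using phase by metis
  have r: "\<And>i. i \<in> ?I \<Longrightarrow> 0 < r i" "\<And>i. i \<in> ?I \<Longrightarrow> r i \<le> R"
    and s: "\<And>i. i \<in> ?I \<Longrightarrow> 0 < s i"
    and lower: "\<And>i z. i \<in> ?I \<Longrightarrow> z \<in> ball 0 (r i) \<Longrightarrow> V z \<noteq> -\<infinity> \<and> H i z + c i \<le> ?v z"
    and onU: "\<And>i z. i \<in> ?I \<Longrightarrow> z \<in> U i \<Longrightarrow> z \<in> ball 0 (r i) \<Longrightarrow> ?v z = H i z + c i"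
    and ray: "\<And>i t. i \<in> ?I \<Longrightarrow> 0 < t \<Longrightarrow> t < s i \<Longrightarrow> ?v (t *\<^sub>R \<xi> i) = H i (t *\<^sub>R \<xi> i) + c i"
    using P unfolding P_def by blast+
  have contH: "continuous_on (ball 0 R) (H i)" if "i \<in> ?I" for i
    using H[OF that] by (rule has_dz_continuous_on)
  have contH': "(H i \<longlongrightarrow> H i z) (nhds z)" if "i \<in> ?I" "z \<in> ball 0 R" for i z
    using contH[OF that(1)] that(2) by (simp add: continuous_on_eq_continuous_at isCont_def tendsto_nhds_iff)
  \<comment> \<open>On the ray of \<open>i\<close>, \<open>V\<close> equals \<open>H i + c i\<close>
    and is at least \<open>H j + c j\<close>. At the origin both harmonic functions vanish, so the
    limit compares the constants alone.\<close>
  have c_le: "c j \<le> c i" if ij: "i \<in> ?I" "j \<in> ?I" for i j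
  proof -
    have lim0: "((\<lambda>t. t *\<^sub>R \<xi> i) \<longlongrightarrow> 0) (at_right (0::real))"
      by (auto intro!: tendsto_eq_intros)
    have lim: "((\<lambda>t. H m (t *\<^sub>R \<xi> i) + c m) \<longlongrightarrow> 0 + c m) (at_right 0)" if "m \<in> ?I" for m
      using filterlim_compose[OF contH'[OF that, of 0] lim0] R assms(13)[OF that]
      by (intro tendsto_add tendsto_const) auto
    have "\<forall>\<^sub>F t in at_right 0. H j (t *\<^sub>R \<xi> i) + c j \<le> H i (t *\<^sub>R \<xi> i) + c i"
    proof -
      have "\<forall>\<^sub>F t in at_right 0. t *\<^sub>R \<xi> i \<in> ball 0 (r j)"
        using lim0 r(1)[OF ij(2)] by (intro topological_tendstoD) auto
      moreover have "\<forall>\<^sub>F t in at_right 0. t \<in> {0<..<s i}"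
        using s[OF ij(1)] by (rule eventually_at_right_real)
      ultimately show ?thesis
      proof eventually_elim
        case (elim t)
        thus ?case using lower[OF ij(2), of "t *\<^sub>R \<xi> i"] ray[OF ij(1), of t] by auto
      qed
    qed
    from tendsto_le[OF trivial_limit_at_right_real lim[OF ij(1)] lim[OF ij(2)] this] show ?thesis by simp
  qed
  define c0 where "c0 = c 1"
  have c: "c i = c0" if "i \<in> ?I" for i
    using c_le[OF one that] c_le[OF that one] by (simp add: c0_def)
  define r0 where "r0 = Min (r ` ?I)"
  have r0: "0 < r0" "\<And>i. i \<in> ?I \<Longrightarrow> r0 \<le> r i" "r0 \<le> R"
  proof -
    show r0i: "r0 \<le> r i" if "i \<in> ?I" for i using that by (simp add: r0_def)
    show "0 < r0" using r(1) one by (auto simp: r0_def)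
    show "r0 \<le> R" using r0i[OF one] r(2)[OF one] by simp
  qed
  define Mx where "Mx z = Max ((\<lambda>\<nu>. H \<nu> z) ` ?I)" for z
  have Mx_ge: "H i z \<le> Mx z" if "i \<in> ?I" for i z using that by (simp add: Mx_def)
  have low: "V z \<noteq> -\<infinity>" "Mx z + c0 \<le> ?v z" if z: "z \<in> ball 0 r0" for z
  proof -
    have "V z \<noteq> -\<infinity> \<and> H i z + c0 \<le> ?v z" if "i \<in> ?I" for i
      using lower[OF that, of z] c[OF that] z r0(2)[OF that] by auto
    moreover have "Mx z \<in> (\<lambda>\<nu>. H \<nu> z) ` ?I" unfolding Mx_def using one by (intro Max_in) auto
    ultimately show "V z \<noteq> -\<infinity>" "Mx z + c0 \<le> ?v z" using one by auto
  qed
  have upp: "?v z \<le> Mx z + c0" if z: "z \<in> ball 0 r0" "z \<notin> K" for z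
  proof -
    have "z \<in> D - K" using z r0(3) assms(2) by auto
    from in_comp[OF this] obtain j where j: "j \<in> ?I" "z \<in> U j" using assms(7) by blast
    have "?v z = H j z + c0" using onU[OF j] c[OF j(1)] z r0(2)[OF j(1)] by auto
    thus ?thesis using Mx_ge[OF j(1)] by simp
  qed
  \<comment> \<open>Index 1 is an arbitrary choice: \<open>le_of_AE_le\<close> needs the exponential
    of \<open>V\<close> minus one of the harmonic functions.\<close>
  obtain M where "bounded_submean (exp_diff (R / 2) V (H 1)) (R / 2) M"
    using bounded_submean_exp_diff[OF sub _ _ g[OF one] H[OF one], of "R / 2"] R by auto
  then interpret F: bounded_submean "exp_diff (R / 2) V (H 1)" "R / 2" M .
  define r1 where "r1 = min r0 (R / 2)"
  have r1: "0 < r1" "r1 \<le> r0" "r1 \<le> R / 2" using r0 R by (auto simp: r1_def)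
  \<comment> \<open>On \<open>K\<close> the upper bound follows from the bound almost everywhere by the mean value inequality.\<close>
  have upp': "?v a \<le> Mx a + c0" if a: "a \<in> ball 0 r1" for a
  proof (rule field_le_epsilon)
    fix e :: real assume e: "0 < e"
    have aR: "a \<in> ball 0 R" using a r1 R by auto
    have "\<forall>\<^sub>F z in nhds a. \<forall>i\<in>?I. dist (H i z) (H i a) < e / 2"
      using contH'[OF _ aR] e by (intro eventually_ball_finite ballI tendstoD) auto
    moreover have "\<forall>\<^sub>F z in nhds a. z \<in> ball 0 r1" using a by (intro eventually_nhds_in_open) auto
    ultimately have "\<forall>\<^sub>F z in nhds a. (\<forall>i\<in>?I. dist (H i z) (H i a) < e / 2) \<and> z \<in> ball 0 r1"
      by (rule eventually_conj)
    then obtain S where S: "open S" "a \<in> S"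
      "\<And>z i. z \<in> S \<Longrightarrow> i \<in> ?I \<Longrightarrow> dist (H i z) (H i a) < e / 2" "S \<subseteq> ball 0 r1"
      unfolding eventually_nhds by blast
    \<comment> \<open>Half of \<open>e\<close> pays for the oscillation of the \<open>H i\<close>
      attaining \<open>Mx z\<close>, the other half for that of \<open>H 1\<close>.\<close>
    define B where "B = Mx a + c0 - H 1 a + e"
    have "AE z in lborel. z \<in> S \<longrightarrow> exp_diff (R / 2) V (H 1) z \<le> exp B"
      using AE_K
    proof (eventually_elim, intro impI)
      fix z assume z: "z \<notin> K" "z \<in> S"
      hence zr: "z \<in> ball 0 r0" "z \<in> ball 0 (R / 2)" using S(4) r1 by auto
      have "Mx z \<in> (\<lambda>\<nu>. H \<nu> z) ` ?I" unfolding Mx_def using one by (intro Max_in) auto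
      then obtain i where i: "i \<in> ?I" "Mx z = H i z" by blast
      have "?v z \<le> H i z + c0" using upp[OF zr(1) z(1)] i by simp
      moreover have "H i z \<le> H i a + e / 2" using S(3)[OF z(2) i(1)] unfolding dist_real_def by linarith
      moreover have "H 1 a \<le> H 1 z + e / 2" using S(3)[OF z(2) one] unfolding dist_real_def by linarith
      ultimately have "?v z - H 1 z \<le> B" using Mx_ge[OF i(1), of a] by (simp add: B_def)
      thus "exp_diff (R / 2) V (H 1) z \<le> exp B" by (simp add: exp_diff_def)
    qed
    hence "exp_diff (R / 2) V (H 1) a \<le> exp B"
      by (intro F.le_of_AE_le[OF S(1,2)]) (use S(4) r1 in auto)
    moreover have "exp_diff (R / 2) V (H 1) a = exp (?v a - H 1 a)"
      using low(1)[of a] a r1 by (simp add: exp_diff_def)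
    ultimately show "?v a \<le> Mx a + c0 + e" by (simp add: B_def)
  qed
  have eq: "V z = ereal (Mx z + c0)" if z: "z \<in> ball 0 r1" for z
  proof -
    have "z \<in> ball 0 r0" "z \<in> ball 0 R" using z r1 r0 by auto
    hence "V z = ereal (?v z)" using low(1)[of z] V_fin[of z] by (cases "V z") auto
    moreover have "?v z = Mx z + c0" using low(2)[of z] upp'[OF z] \<open>z \<in> ball 0 r0\<close> by simp
    ultimately show ?thesis by simp
  qed
  have "\<forall>\<^sub>F z in nhds 0. z \<in> ball 0 r1" using r1(1) by (intro eventually_nhds_in_open) auto
  hence "\<forall>\<^sub>F z in nhds 0. V z = ereal (Mx z + c0)" by (rule eventually_mono) (rule eq)
  thus ?thesis unfolding Mx_def by blast
qed

end
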